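(* Let $\varphi:\mathbb{D}\to\mathbb{C}$ be a Ma–Minda function with expansion $\varphi(z)=1+B_1z+B_2z^2+B_3z^3+B_4z^4+\cdots$, $B_1>0$ (so all $B_i$ are real), whose coefficients satisfy all four of the following conditions: (C1) $|B_1^2+2B_2|<2B_1$ (equivalently $|B_1^2+2B_2|^2<4B_1^2$); (C2) $|B_1^3-B_1^2B_2+18B_2^2-18B_1B_3|<3\,|(B_1^2+2B_1+2B_2)(2B_1^2-3B_1+3B_2)|$; (C3) $|N|<8|D|$, where $$\begin{aligned}N={}&30B_1^7-9B_1^8-B_1^6(66B_2-5)-648B_2^3+324B_2^4+B_1^5(170B_2-126)-648B_2B_3^2\\&+B_1^3(-180B_2+220B_2^2+108B_3-360B_2B_3)+B_1(1296B_2B_3-720B_2^2B_3)+648B_2^2B_4\\&+B_1^4(108+10B_2-175B_2^2+90B_3+162B_4)\\&+B_1^2(-144B_2^2+4B_2^3+180B_2B_3-324B_3^2-648B_4+648B_2B_4),\end{aligned}$$ $$\begin{aligned}D={}&9B_1^6+9B_1^7+B_1^4(-27+32B_2)+B_1^5(-52+63B_2)+162B_2^2B_3\\&+B_1^3(81-189B_2+164B_2^2+9B_3)+B_1^2(18B_2^2-9B_2B_3)+B_1(-162B_2^2+198B_2^3-81B_3^2);\end{aligned}$$ (C4) $0<\dfrac{4B_1^2+6(B_2-B_1)}{3B_1^2+6(B_2-B_1)}<1$. If $f(z)=z+\sum_{n=2}^\infty a_nz^n$ belongs to $\mathcal{C}(\varphi)$, then $$|a_5|\le \frac{B_1}{20}.$$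 The inequality is sharp: for each such $\varphi$ there is a function in $\mathcal{C}(\varphi)$ for which equality holds.
   Context: $\mathbb{D}=\{z\in\mathbb{C}:|z|<1\}$. $\mathcal{A}$ is the class of analytic functions on $\mathbb{D}$ of the form $f(z)=z+\sum_{n=2}^\infty a_nz^n$. A Schwarz function is an analytic $\omega:\mathbb{D}\to\mathbb{D}$ with $\omega(0)=0$. For analytic $f,g$ on $\mathbb{D}$, $f\prec g$ (subordination) means there is a Schwarz function $\omega$ with $f(z)=g(\omega(z))$ for all $z\in\mathbb{D}$. A Ma–Minda function is an analytic univalent function $\varphi$ on $\mathbb{D}$ such that (i) $\operatorname{Re}\varphi(z)>0$ for $z\in\mathbb{D}$; (ii) $\varphi'(0)>0$; (iii) $\varphi(\mathbb{D})$ is a starlike domain with respect to $\varphi(0)=1$; (iv) $\varphi(\mathbb{D})$ is symmetric about the real axis. Then $\overline{\varphi(\bar z)}=\varphi(z)$ and all Taylor coefficients of $\varphi$ are real. $\mathcal{C}(\varphi)=\{f\in\mathcal{A}: 1+zf''(z)/f'(z)\prec\varphi(z)\}$. *)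

theory Defs
  imports "HOL-Complex_Analysis.Complex_Analysis"
begin

abbreviation unit_disc :: "complex set" where
  "unit_disc \<equiv> ball 0 1"

abbreviation taylor_coeff :: "(complex \<Rightarrow> complex) \<Rightarrow> nat \<Rightarrow> complex" where
  "taylor_coeff f n \<equiv> fps_nth (fps_expansion f 0) n"

definition normalized_analytic :: "(complex \<Rightarrow> complex) set" where
  "normalized_analytic =
     {f. f holomorphic_on unit_disc \<and> taylor_coeff f 0 = 0 \<and> taylor_coeff f 1 = 1}"

definition schwarz_function :: "(complex \<Rightarrow> complex) \<Rightarrow> bool" where
  "schwarz_function \<omega> \<longleftrightarrow>
     \<omega> holomorphic_on unit_disc \<and> \<omega> \<in> unit_disc \<rightarrow> unit_disc \<and> \<omega> 0 = 0"

definition subordinate :: "(complex \<Rightarrow> complex) \<Rightarrow> (complex \<Rightarrow> complex) \<Rightarrow> bool"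
    (infix "\<prec>\<^sub>D" 50) where
  "f \<prec>\<^sub>D g \<longleftrightarrow> f holomorphic_on unit_disc \<and> g holomorphic_on unit_disc \<and>
     (\<exists>\<omega>. schwarz_function \<omega> \<and> (\<forall>z\<in>unit_disc. f z = g (\<omega> z)))"

(* The conjunct deriv phi 0 : Reals makes sense of the inequality phi'(0) > 0.
   The library predicate starlike leaves the centre unspecified, so star-shapedness
   with respect to 1 is written out. *)
definition ma_minda :: "(complex \<Rightarrow> complex) \<Rightarrow> bool" where
  "ma_minda \<phi> \<longleftrightarrow>
     \<phi> holomorphic_on unit_disc \<and> inj_on \<phi> unit_disc \<and>
     (\<forall>z\<in>unit_disc. Re (\<phi> z) > 0) \<and>
     deriv \<phi> 0 \<in> \<real> \<and> Re (deriv \<phi> 0) > 0 \<and>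
     \<phi> 0 = 1 \<and> (\<forall>w\<in>\<phi> ` unit_disc. closed_segment 1 w \<subseteq> \<phi> ` unit_disc) \<and>
     cnj ` (\<phi> ` unit_disc) = \<phi> ` unit_disc"

(* deriv f z \<noteq> 0 says that the quotient is defined on the whole disc; it guards
   against the convention x / 0 = 0. *)
definition ma_minda_convex :: "(complex \<Rightarrow> complex) \<Rightarrow> (complex \<Rightarrow> complex) set" where
  "ma_minda_convex \<phi> =
     {f \<in> normalized_analytic. (\<forall>z\<in>unit_disc. deriv f z \<noteq> 0) \<and>
        (\<lambda>z. 1 + z * deriv (deriv f) z / deriv f z) \<prec>\<^sub>D \<phi>}"

definition N_poly :: "real \<Rightarrow> real \<Rightarrow> real \<Rightarrow> real \<Rightarrow> real" where
  "N_poly B1 B2 B3 B4 =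
     30 * B1^7 - 9 * B1^8 - B1^6 * (66 * B2 - 5) - 648 * B2^3 + 324 * B2^4
     + B1^5 * (170 * B2 - 126) - 648 * B2 * B3^2
     + B1^3 * (- 180 * B2 + 220 * B2^2 + 108 * B3 - 360 * B2 * B3)
     + B1 * (1296 * B2 * B3 - 720 * B2^2 * B3) + 648 * B2^2 * B4
     + B1^4 * (108 + 10 * B2 - 175 * B2^2 + 90 * B3 + 162 * B4)
     + B1^2 * (- 144 * B2^2 + 4 * B2^3 + 180 * B2 * B3 - 324 * B3^2 - 648 * B4
               + 648 * B2 * B4)"

definition D_poly :: "real \<Rightarrow> real \<Rightarrow> real \<Rightarrow> real" where
  "D_poly B1 B2 B3 =
     9 * B1^6 + 9 * B1^7 + B1^4 * (- 27 + 32 * B2) + B1^5 * (- 52 + 63 * B2)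
     + 162 * B2^2 * B3
     + B1^3 * (81 - 189 * B2 + 164 * B2^2 + 9 * B3)
     + B1^2 * (18 * B2^2 - 9 * B2 * B3)
     + B1 * (- 162 * B2^2 + 198 * B2^3 - 81 * B3^2)"

lemma ma_minda_reflect:
  assumes "ma_minda \<phi>" and z: "z \<in> unit_disc"
  shows "cnj (\<phi> (cnj z)) = \<phi> z"
proof -
  have hol: "\<phi> holomorphic_on unit_disc" and inj: "inj_on \<phi> unit_disc"
    and re: "deriv \<phi> 0 \<in> \<real>" and pos: "Re (deriv \<phi> 0) > 0" and \<phi>0: "\<phi> 0 = 1"
    and sym: "cnj ` (\<phi> ` unit_disc) = \<phi> ` unit_disc"
    using assms(1) unfolding ma_minda_def by auto
  obtain g where g: "g holomorphic_on (\<phi> ` unit_disc)"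
    and dg: "\<And>z. z \<in> unit_disc \<Longrightarrow> deriv \<phi> z * deriv g (\<phi> z) = 1"
    and gf: "\<And>z. z \<in> unit_disc \<Longrightarrow> g (\<phi> z) = z"
    using holomorphic_has_inverse[OF hol _ inj] by auto
  define \<psi> where "\<psi> = cnj \<circ> \<phi> \<circ> cnj"
  have der: "(\<psi> has_field_derivative cnj (deriv \<phi> (cnj w))) (at w)" if "w \<in> unit_disc" for w
  proof -
    have "(\<phi> has_field_derivative deriv \<phi> (cnj w)) (at (cnj w))"
      using hol that by (intro holomorphic_derivI[of _ unit_disc]) auto
    thus ?thesis unfolding \<psi>_def using has_field_derivative_cnj_cnj by blast
  qed
  have hol\<psi>: "\<psi> holomorphic_on unit_disc"
    using der holomorphic_on_open by blast
  have im: "\<psi> w \<in> \<phi> ` unit_disc" if "w \<in> unit_disc" for w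
  proof -
    have "cnj w \<in> unit_disc" using that by simp
    hence "cnj (\<phi> (cnj w)) \<in> cnj ` (\<phi> ` unit_disc)" by blast
    thus ?thesis unfolding sym by (simp add: \<psi>_def)
  qed
  define h where "h = g \<circ> \<psi>"
  have holh: "h holomorphic_on unit_disc"
    unfolding h_def using hol\<psi> g im by (intro holomorphic_on_compose_gen) auto
  have h0: "h 0 = 0" using gf[of 0] \<phi>0 by (simp add: h_def \<psi>_def)
  have hin: "h w \<in> unit_disc \<and> \<phi> (h w) = \<psi> w" if w: "w \<in> unit_disc" for w
    using im[OF w] gf unfolding h_def by auto
  have dh: "deriv h 0 = 1"
  proof -
    have "open (\<phi> ` unit_disc)"
      using open_mapping_thm3[OF hol _ inj] by simp
    hence "(g has_field_derivative deriv g 1) (at 1)"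
      using g \<phi>0 by (intro holomorphic_derivI[of _ "\<phi> ` unit_disc"]) force+
    hence "(h has_field_derivative deriv g 1 * cnj (deriv \<phi> 0)) (at 0)"
      unfolding h_def using der[of 0] \<phi>0 by (intro DERIV_chain) (auto simp: \<psi>_def)
    moreover have "cnj (deriv \<phi> 0) = deriv \<phi> 0" using re by (simp add: Reals_cnj_iff)
    ultimately show ?thesis using dg[of 0] \<phi>0 by (simp add: DERIV_imp_deriv mult.commute)
  qed
  obtain \<alpha> where \<alpha>: "\<And>w. norm w < 1 \<Longrightarrow> h w = \<alpha> * w"
    using Schwarz_Lemma(3)[OF holh h0, of 0] hin dh by force
  have "((\<lambda>w. \<alpha> * w) has_field_derivative \<alpha>) (at 0)"
    by (auto intro!: derivative_eq_intros)
  hence "(h has_field_derivative \<alpha>) (at 0)"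
    by (rule has_field_derivative_transform_within_open[of _ _ _ unit_disc]) (auto simp: \<alpha>)
  hence "\<alpha> = 1" using dh DERIV_imp_deriv by force
  with hin[OF z] \<alpha>[of z] z show ?thesis by (simp add: \<psi>_def)
qed

lemma ma_minda_taylor_coeff_real:
  assumes "ma_minda \<phi>"
  shows "taylor_coeff \<phi> n \<in> \<real>"
proof -
  have hol: "\<phi> holomorphic_on unit_disc" using assms unfolding ma_minda_def by auto
  have s: "(\<lambda>n. taylor_coeff \<phi> n * z ^ n) sums \<phi> z" if "z \<in> unit_disc" for z
    using holomorphic_power_series[OF hol that] by (simp add: fps_expansion_def)
  have sc: "(\<lambda>n. cnj (taylor_coeff \<phi> n) * z ^ n) sums \<phi> z" if "z \<in> unit_disc" for z
  proof -
    have "(\<lambda>n. cnj (taylor_coeff \<phi> n * cnj z ^ n)) sums cnj (\<phi> (cnj z))"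
      using s[of "cnj z"] that by (subst sums_cnj) auto
    thus ?thesis using ma_minda_reflect[OF assms that] by simp
  qed
  have "eventually (\<lambda>z. z \<in> unit_disc) (nhds (0::complex))"
    by (intro eventually_nhds_in_open) auto
  hence "\<phi> has_fps_expansion Abs_fps (\<lambda>n. cnj (taylor_coeff \<phi> n))"
    by (intro has_fps_expansionI) (simp add: eventually_mono sc)
  hence "fps_expansion \<phi> 0 = Abs_fps (\<lambda>n. cnj (taylor_coeff \<phi> n))"
    by (rule fps_expansion_eqI)
  hence "cnj (taylor_coeff \<phi> n) = taylor_coeff \<phi> n" by (metis fps_nth_Abs_fps)
  thus ?thesis by (simp add: Reals_cnj_iff)
qed

end

theory Submission
  imports Defs
begin

text \<open>
  Write \<open>1 + z f'' / f' = \<phi> \<circ> \<omega>\<close> with a Schwarz function \<open>\<omega>\<close>. Then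
  \<open>20 a\<^sub>5 / B\<^sub>1\<close> is a polynomial in the first four coefficients of \<open>\<omega>\<close> with leading term
  \<open>\<omega>\<^sub>4\<close>. Put \<open>p = (1 + \<omega>) / (1 - \<omega>)\<close>, let \<open>q z\<close> be the average of \<open>p z\<close> and \<open>p (- z)\<close>
  with weights \<open>(1 + s) / 2\<close> and \<open>(1 - s) / 2\<close>, where \<open>s\<^sup>2\<close> is the quotient in (C4), and let
  \<open>W = (q - 1) / (q + 1)\<close>. Matching coefficients,
  \<open>20 a\<^sub>5 / B\<^sub>1\<close> is the fourth coefficient of \<open>W - m\<^sub>1 W\<^sup>2 + m\<^sub>2 W\<^sup>3 - m\<^sub>3 W\<^sup>4\<close> for real
  numbers \<open>m\<^sub>k\<close> determined by the \<open>B\<^sub>i\<close>. Conditions (C1), (C2), (C3) say exactly that the Schur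
  parameters of \<open>1 + 2 m\<^sub>1 z + 2 m\<^sub>2 z\<^sup>2 + 2 m\<^sub>3 z\<^sup>3 + \<dots>\<close> lie in the open unit interval
  around 0, so that the \<open>m\<^sub>k\<close> are moments of a probability measure on the unit circle. The
  coefficient is thus an average of fourth coefficients of \<open>W / (1 + x W)\<close> with \<open>|x| = 1\<close>, and
  each of these is at most 1 in modulus because \<open>(1 - x W) / (1 + x W)\<close> has positive real part.
  Equality holds for \<open>\<omega> z = z\<^sup>4\<close>.
\<close>

subsection \<open>Herglotz integrals and coefficient bounds\<close>

lemma fps_expansion_of_holomorphic:
  assumes "f holomorphic_on unit_disc"
  shows "f has_fps_expansion fps_expansion f 0"
  using assms by (intro analytic_at_imp_has_fps_expansion_0) (auto simp: analytic_at intro!: exI[of _ unit_disc])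

lemma taylor_coeff_0: "taylor_coeff f 0 = f 0"
  by (simp add: fps_expansion_def)

lemma fps_eq_of_eq_on_disc:
  assumes "f has_fps_expansion F" "g has_fps_expansion G" "\<And>z. z \<in> unit_disc \<Longrightarrow> f z = g z"
  shows "F = G"
proof -
  have "eventually (\<lambda>z. z \<in> unit_disc) (nhds (0::complex))"
    by (intro eventually_nhds_in_open) auto
  hence "eventually (\<lambda>z. f z = g z) (nhds 0)"
    by (rule eventually_mono) (use assms(3) in auto)
  hence "g has_fps_expansion F"
    using assms(1) has_fps_expansion_cong by blast
  thus ?thesis using assms(2) fps_expansion_unique_complex by blast
qed

lemma residue_factor_cancel:
  fixes x R H :: complex
  assumes "x \<noteq> 0" "R \<noteq> 0"
  shows "(- \<i> * R ^ k) * (H / (R * x) ^ Suc k * R * \<i> * x) = H * inverse (x ^ k)"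
  using assms by (simp add: divide_simps power_mult_distrib mult_ac)

lemma power_factor_cancel:
  fixes x R H :: complex
  assumes "R \<noteq> 0"
  shows "(- \<i> / R ^ Suc k) * (H * (R * x) ^ k * R * \<i> * x) = H * x ^ Suc k"
  using assms by (simp add: divide_simps power_mult_distrib mult_ac)

text \<open>Cauchy's formula for higher derivatives on the circle of radius \<open>r\<close>,
  rescaled so that it reads off a Fourier coefficient of \<open>h\<close> on that circle.\<close>

lemma circle_integral_cis_minus:
  assumes h: "h holomorphic_on unit_disc" and r: "0 < r" "r < 1"
  shows "((\<lambda>t. h (of_real r * cis t) * cis (- (real k * t))) has_integral
           2 * of_real pi * taylor_coeff h k * of_real (r ^ k)) {0..2*pi}"
proof -
  have "((\<lambda>u. h u / (u - 0) ^ Suc k) has_contour_integral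
          (2 * pi * \<i>) / (fact k) * (deriv ^^ k) h 0) (circlepath 0 r)"
  proof (rule Cauchy_has_contour_integral_higher_derivative_circlepath)
    have "cball 0 r \<subseteq> unit_disc" "ball 0 r \<subseteq> unit_disc" using r by auto
    thus "continuous_on (cball 0 r) h" "h holomorphic_on ball 0 r"
      using h holomorphic_on_subset holomorphic_on_imp_continuous_on by blast+
  qed (use r in auto)
  hence "((\<lambda>t. h (of_real r * cis t) / (of_real r * cis t) ^ Suc k * of_real r * \<i> * cis t)
           has_integral (2 * of_real pi * \<i>) * taylor_coeff h k) {0..2*pi}"
    unfolding circlepath_def
    by (subst (asm) has_contour_integral_part_circlepath_iff) (auto simp: fps_expansion_def)
  hence "((\<lambda>t. (- \<i> * of_real r ^ k) *
             (h (of_real r * cis t) / (of_real r * cis t) ^ Suc k * of_real r * \<i> * cis t))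
           has_integral (- \<i> * of_real r ^ k) * ((2 * of_real pi * \<i>) * taylor_coeff h k)) {0..2*pi}"
    by (rule has_integral_mult_right)
  moreover have "(- \<i> * of_real r ^ k) *
             (h (of_real r * cis t) / (of_real r * cis t) ^ Suc k * of_real r * \<i> * cis t)
       = h (of_real r * cis t) * cis (- (real k * t))" for t
  proof -
    have "cis (- (real k * t)) = inverse (cis t ^ k)" by (simp add: Complex.DeMoivre)
    thus ?thesis using residue_factor_cancel[of "cis t" "of_real r"] r by simp
  qed
  ultimately show ?thesis by (simp add: mult_ac)
qed

text \<open>Cauchy's theorem for \<open>h u * u ^ k\<close>: on a circle about 0, a holomorphic
  function has no Fourier modes of negative frequency.\<close>

lemma circle_integral_cis_plus:
  assumes h: "h holomorphic_on unit_disc" and r: "0 < r" "r < 1"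
  shows "((\<lambda>t. h (of_real r * cis t) * cis (real (Suc k) * t)) has_integral 0) {0..2*pi}"
proof -
  have "((\<lambda>u. h u * u ^ k) has_contour_integral 0) (circlepath 0 r)"
    by (rule Cauchy_theorem_disc_simple[of _ 0 1]) (use h r in \<open>auto intro!: holomorphic_intros\<close>)
  hence "((\<lambda>t. h (of_real r * cis t) * (of_real r * cis t) ^ k * of_real r * \<i> * cis t)
           has_integral 0) {0..2*pi}"
    unfolding circlepath_def
    by (subst (asm) has_contour_integral_part_circlepath_iff) auto
  hence "((\<lambda>t. (- \<i> / of_real r ^ Suc k) *
      (h (of_real r * cis t) * (of_real r * cis t) ^ k * of_real r * \<i> * cis t))
           has_integral (- \<i> / of_real r ^ Suc k) * 0) {0..2*pi}"
    by (rule has_integral_mult_right)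
  moreover have "(- \<i> / of_real r ^ Suc k) *
      (h (of_real r * cis t) * (of_real r * cis t) ^ k * of_real r * \<i> * cis t)
     = h (of_real r * cis t) * cis (real (Suc k) * t)" for t
  proof -
    have "cis (real (Suc k) * t) = cis t ^ Suc k" by (rule Complex.DeMoivre[symmetric])
    thus ?thesis using power_factor_cancel[of "of_real r"] r by simp
  qed
  ultimately show ?thesis by (simp only: mult_zero_right)
qed

text \<open>Write \<open>2 * Re h\<close> as \<open>h + cnj h\<close>. At the nonzero frequency
  \<open>Suc k\<close> the conjugate part integrates to zero, which leaves \<open>pi\<close> in
  place of \<open>2 * pi\<close>.\<close>

lemma circle_integral_Re:
  assumes h: "h holomorphic_on unit_disc" and r: "0 < r" "r < 1"
  shows "((\<lambda>t. of_real (Re (h (of_real r * cis t))) * cis (- (real (Suc k) * t))) has_integral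
           of_real pi * taylor_coeff h (Suc k) * of_real (r ^ Suc k)) {0..2*pi}"
proof -
  have "((\<lambda>t. cnj (h (of_real r * cis t) * cis (real (Suc k) * t))) has_integral cnj 0) {0..2*pi}"
    by (rule has_integral_cnj[THEN iffD2, unfolded o_def, OF circle_integral_cis_plus[OF assms]])
  from has_integral_mult_right[OF has_integral_add[OF circle_integral_cis_minus[OF assms, of "Suc k"] this], of "1/2"]
  have "((\<lambda>t. 1 / 2 * (h (of_real r * cis t) * cis (- (real (Suc k) * t)) +
           cnj (h (of_real r * cis t) * cis (real (Suc k) * t)))) has_integral
           1 / 2 * (2 * of_real pi * taylor_coeff h (Suc k) * of_real (r ^ Suc k) + cnj 0)) {0..2*pi}" .
  moreover have "1 / 2 * (h (of_real r * cis t) * cis (- (real (Suc k) * t)) +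
           cnj (h (of_real r * cis t) * cis (real (Suc k) * t))) =
     of_real (Re (h (of_real r * cis t))) * cis (- (real (Suc k) * t))" for t
  proof -
    have "cnj (cis (real (Suc k) * t)) = cis (- (real (Suc k) * t))" by (rule cis_cnj)
    hence "1 / 2 * (h (of_real r * cis t) * cis (- (real (Suc k) * t)) +
           cnj (h (of_real r * cis t) * cis (real (Suc k) * t))) =
        1 / 2 * (h (of_real r * cis t) + cnj (h (of_real r * cis t))) * cis (- (real (Suc k) * t))"
      by (simp only: complex_cnj_mult distrib_left distrib_right mult.assoc)
    thus ?thesis by (simp only: complex_add_cnj) (simp del: of_nat_Suc)
  qed
  ultimately show ?thesis by (simp add: mult.assoc del: of_nat_Suc)
qed

lemma circle_integral_Re_0:
  assumes h: "h holomorphic_on unit_disc" and r: "0 < r" "r < 1"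
  shows "((\<lambda>t. Re (h (of_real r * cis t))) has_integral 2 * pi * Re (h 0)) {0..2*pi}"
  using has_integral_Re[OF circle_integral_cis_minus[OF assms, of 0]]
  by (simp add: taylor_coeff_0)

text \<open>Coefficient bounds are first obtained from circles of radius \<open>r < 1\<close>; this
  is the passage to \<open>r = 1\<close>.\<close>

lemma norm_le_left_limit:
  fixes f :: "real \<Rightarrow> complex"
  assumes "isCont f 1" "\<And>r. 0 < r \<Longrightarrow> r < 1 \<Longrightarrow> norm (f r) \<le> b"
  shows "norm (f 1) \<le> b"
proof (rule tendsto_upperbound)
  show "((\<lambda>r. norm (f r)) \<longlongrightarrow> norm (f 1)) (at_left 1)"
    using assms(1) by (intro tendsto_norm) (simp add: isCont_def filterlim_at_split)
  show "eventually (\<lambda>r. norm (f r) \<le> b) (at_left (1::real))"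
    using eventually_at_left_real[of 0 "1::real"] by (rule eventually_mono) (auto intro: assms(2))
qed simp

text \<open>Caratheodory's bound: up to the factor \<open>r ^ Suc k / 2\<close>, the coefficient is
  a Fourier coefficient of the nonnegative density \<open>Re p / (2 * pi)\<close> of total mass
  1.\<close>

lemma caratheodory_coeff_bound:
  assumes p: "p holomorphic_on unit_disc" and Re: "\<And>z. z \<in> unit_disc \<Longrightarrow> Re (p z) \<ge> 0"
    and p0: "p 0 = 1"
  shows "norm (taylor_coeff p (Suc k)) \<le> 2"
proof -
  have "norm (taylor_coeff p (Suc k) * of_real (r ^ Suc k)) \<le> 2" if r: "0 < r" "r < 1" for r
  proof -
    note I = circle_integral_Re[OF p r, of k] and J = circle_integral_Re_0[OF p r]
    have "norm (integral {0..2*pi} (\<lambda>t. of_real (Re (p (of_real r * cis t))) * cis (- (real (Suc k) * t))))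
        \<le> integral {0..2*pi} (\<lambda>t. Re (p (of_real r * cis t)))"
    proof (rule integral_norm_bound_integral)
      fix t
      have "Re (p (of_real r * cis t)) \<ge> 0" using r by (intro Re) (simp add: norm_mult)
      thus "norm (of_real (Re (p (of_real r * cis t))) * cis (- (real (Suc k) * t)))
              \<le> Re (p (of_real r * cis t))"
        by (simp add: norm_mult del: of_nat_Suc)
    qed (use I J in \<open>auto simp: integrable_on_def\<close>)
    hence "norm (of_real pi * (taylor_coeff p (Suc k) * of_real (r ^ Suc k))) \<le> 2 * pi"
      using integral_unique[OF I] integral_unique[OF J] p0 by (simp add: mult.assoc)
    thus ?thesis by (simp only: norm_mult) simp
  qed
  from norm_le_left_limit[of "\<lambda>r. taylor_coeff p (Suc k) * of_real (r ^ Suc k)", OF _ this]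
  show ?thesis by (simp del: of_real_power power_Suc)
qed

lemma cayley_Re_pos:
  fixes w :: complex
  assumes "norm w < 1"
  shows "Re ((1 + w) / (1 - w)) > 0"
proof -
  have "w \<noteq> 1" using assms by auto
  have "Re ((1 + w) / (1 - w)) = (1 - (norm w)\<^sup>2) / (norm (1 - w))\<^sup>2"
    unfolding Re_divide cmod_power2 by (simp add: power2_eq_square algebra_simps)
  moreover have "(norm w)\<^sup>2 < 1" using assms by (simp add: power_less_one_iff)
  ultimately show ?thesis using \<open>w \<noteq> 1\<close> by simp
qed

text \<open>\<open>P\<close> is \<open>(1 + V) / (1 - V)\<close>, that is 1 plus twice the sum of
  the positive powers of \<open>V\<close>. Since \<open>V ^ k\<close> starts at order
  \<open>k\<close> or later, a finite telescoped form of the geometric series suffices.\<close>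

lemma fps_geometric_coeff:
  fixes P V :: "'a :: comm_ring_1 fps"
  assumes P: "P * (1 - V) = 1 + V" and V0: "fps_nth V 0 = 0"
  shows "fps_nth P (Suc N) = 2 * (\<Sum>k\<le>N. fps_nth (V ^ Suc k) (Suc N))"
proof -
  have rec: "P - 1 = 2 * V + V * (P - 1)" using P by (simp add: algebra_simps)
  have it: "P - 1 = 2 * (\<Sum>k<n. V ^ Suc k) + V ^ n * (P - 1)" for n
  proof (induction n)
    case (Suc n)
    have "V ^ n * (P - 1) = V ^ n * (2 * V + V * (P - 1))" by (subst (1) rec) simp
    also have "\<dots> = 2 * V ^ Suc n + V ^ Suc n * (P - 1)" by (simp add: algebra_simps)
    finally have "P - 1 = 2 * (\<Sum>k<n. V ^ Suc k) + (2 * V ^ Suc n + V ^ Suc n * (P - 1))"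
      using Suc.IH by metis
    thus ?case by (simp only: sum.lessThan_Suc distrib_left add.assoc)
  qed simp
  have "fps_nth (P - 1) 0 = 0"
    using arg_cong[OF rec, of "\<lambda>F. fps_nth F 0"] V0 by simp
  moreover have "fps_nth (V ^ Suc N) i = 0" if "i < Suc N" for i
    using startsby_zero_power_prefix[OF V0] that by blast
  \<comment> \<open>The remainder has order at least \<open>N + 2\<close>: one factor vanishes below
    order \<open>Suc N\<close>, the other has no constant term.\<close>
  ultimately have "fps_nth (V ^ Suc N * (P - 1)) (Suc N) = 0"
    unfolding fps_mult_nth by (intro sum.neutral) (metis atLeastAtMost_iff diff_self_eq_0 le_neq_implies_less mult_zero_left mult_zero_right)
  moreover have "fps_nth P (Suc N) = fps_nth (P - 1) (Suc N)" by simp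
  ultimately have "fps_nth P (Suc N) = fps_nth (2 * (\<Sum>k<Suc N. V ^ Suc k)) (Suc N)"
    using it[of "Suc N"] by (metis add.right_neutral fps_add_nth)
  thus ?thesis
    by (simp only: fps_mult_numeral_left fps_numeral_nth lessThan_Suc_atMost fps_sum_nth
        flip: mult.assoc)
qed

text \<open>
  The sum is, up to the factor \<open>- 2 x\<close>, a coefficient of \<open>(1 - x W) / (1 + x W)\<close>.
\<close>
lemma schwarz_kernel_coeff_bound:
  assumes W: "schwarz_function W" and x: "norm x = 1"
  shows "norm (\<Sum>k\<le>N. (- x) ^ k * fps_nth (fps_expansion W 0 ^ Suc k) (Suc N)) \<le> 1"
proof -
  define F where "F = fps_expansion W 0"
  define V where "V = (\<lambda>z. - x * W z)"
  define p where "p = (\<lambda>z. (1 + V z) / (1 - V z))"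
  have holW: "W holomorphic_on unit_disc" and W0: "W 0 = 0"
    and Wn: "\<And>z. z \<in> unit_disc \<Longrightarrow> norm (W z) < 1"
    using W by (auto simp: schwarz_function_def)
  have Vn: "norm (V z) < 1" if "z \<in> unit_disc" for z
    using Wn[OF that] x by (simp add: V_def norm_mult)
  hence V1: "1 - V z \<noteq> 0" if "z \<in> unit_disc" for z using that by fastforce
  have holV: "V holomorphic_on unit_disc" unfolding V_def by (intro holomorphic_intros holW)
  have holp: "p holomorphic_on unit_disc"
    unfolding p_def using V1 by (intro holomorphic_intros holV) auto
  have "V has_fps_expansion fps_const (- x) * F"
    unfolding V_def F_def by (intro fps_expansion_intros fps_expansion_of_holomorphic holW)
  moreover define G where "G = fps_const (- x) * F"
  ultimately have G: "V has_fps_expansion G" by simp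
  have "fps_expansion p 0 * (1 - G) = 1 + G"
  proof (rule fps_eq_of_eq_on_disc)
    show "(\<lambda>z. p z * (1 - V z)) has_fps_expansion fps_expansion p 0 * (1 - G)"
      by (intro fps_expansion_intros fps_expansion_of_holomorphic holp G)
    show "(\<lambda>z. 1 + V z) has_fps_expansion 1 + G"
      by (intro fps_expansion_intros G)
  qed (use V1 in \<open>auto simp: p_def\<close>)
  moreover have "fps_nth G 0 = 0" by (simp add: G_def F_def fps_expansion_def W0)
  ultimately have "taylor_coeff p (Suc N) = 2 * (\<Sum>k\<le>N. fps_nth (G ^ Suc k) (Suc N))"
    by (rule fps_geometric_coeff)
  also have "\<dots> = 2 * (- x * (\<Sum>k\<le>N. (- x) ^ k * fps_nth (F ^ Suc k) (Suc N)))"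
    unfolding G_def power_mult_distrib fps_const_power fps_mult_left_const_nth
    by (simp add: sum_distrib_left mult.assoc del: power_Suc) (simp add: mult.assoc)
  finally have "norm (taylor_coeff p (Suc N)) =
       2 * norm (\<Sum>k\<le>N. (- x) ^ k * fps_nth (F ^ Suc k) (Suc N))"
    using x by (simp add: norm_mult)
  moreover have "norm (taylor_coeff p (Suc N)) \<le> 2"
  proof (rule caratheodory_coeff_bound[OF holp])
    show "Re (p z) \<ge> 0" if "z \<in> unit_disc" for z
      using cayley_Re_pos[OF Vn[OF that]] by (simp add: p_def)
    show "p 0 = 1" by (simp add: p_def V_def W0)
  qed
  ultimately show ?thesis by (simp add: F_def)
qed

text \<open>
  Herglotz' representation on circles of radius \<open>r < 1\<close> writes the numbers
  \<open>taylor_coeff h k / 2\<close>, scaled by \<open>r ^ k\<close>, as moments of the probability density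
  \<open>Re (h (r e\<^sup>i\<^sup>t)) / (2 \<pi>)\<close>, and integrates the previous bound.
\<close>
lemma livingston_coeff_bound:
  fixes N :: nat
  assumes h: "h holomorphic_on unit_disc" and Re: "\<And>z. z \<in> unit_disc \<Longrightarrow> Re (h z) \<ge> 0"
    and h0: "h 0 = 1" and W: "schwarz_function W"
  defines "u \<equiv> \<lambda>k. fps_nth (fps_expansion W 0 ^ Suc k) (Suc N)"
  shows "norm (u 0 + (\<Sum>k<N. (- 1) ^ Suc k * (taylor_coeff h (Suc k) / 2) * u (Suc k))) \<le> 1"
proof -
  let ?f = "\<lambda>r. u 0 + (\<Sum>k<N. (- 1) ^ Suc k * (taylor_coeff h (Suc k) / 2) * u (Suc k) * of_real (r ^ Suc k))"
  have "norm (?f r) \<le> 1" if r: "0 < r" "r < 1" for r :: real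
  proof -
    define R where "R = (\<lambda>t. Re (h (of_real r * cis t)))"
    define S where "S = (\<lambda>x. \<Sum>k\<le>N. (- x) ^ k * u k)"
    have J: "(R has_integral 2 * pi) {0..2*pi}"
      using circle_integral_Re_0[OF h r] h0 by (simp add: R_def)
    have I: "((\<lambda>t. u 0 * of_real (R t) +
            (\<Sum>k<N. (- 1) ^ Suc k * u (Suc k) * (of_real (R t) * cis (- (real (Suc k) * t)))))
          has_integral u 0 * of_real (2 * pi) + (\<Sum>k<N. (- 1) ^ Suc k * u (Suc k) *
            (of_real pi * taylor_coeff h (Suc k) * of_real (r ^ Suc k)))) {0..2*pi}"
      unfolding R_def
      by (intro has_integral_add has_integral_sum has_integral_mult_right has_integral_of_real
                circle_integral_Re[OF h r] J[unfolded R_def]) auto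
    have RS: "u 0 * of_real (R t) +
            (\<Sum>k<N. (- 1) ^ Suc k * u (Suc k) * (of_real (R t) * cis (- (real (Suc k) * t))))
         = of_real (R t) * S (cis (- t))" for t
    proof -
      have "(- cis (- t)) ^ k = (- 1) ^ k * cis (- (real k * t))" for k
        by (subst power_minus) (simp add: Complex.DeMoivre)
      hence "S (cis (- t)) = (\<Sum>k<Suc N. (- 1) ^ k * cis (- (real k * t)) * u k)"
        by (simp add: S_def lessThan_Suc_atMost)
      also have "\<dots> = u 0 + (\<Sum>k<N. (- 1) ^ Suc k * cis (- (real (Suc k) * t)) * u (Suc k))"
        by (subst sum.lessThan_Suc_shift) simp
      finally show ?thesis
        by (simp add: distrib_left sum_distrib_left mult_ac del: of_nat_Suc power_Suc)
    qed
    have "norm (integral {0..2*pi} (\<lambda>t. of_real (R t) * S (cis (- t)))) \<le> integral {0..2*pi} R"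
    proof (rule integral_norm_bound_integral)
      fix t
      have "R t \<ge> 0" unfolding R_def using r by (intro Re) (simp add: norm_mult)
      moreover have "norm (S (cis (- t))) \<le> 1"
        unfolding S_def u_def by (rule schwarz_kernel_coeff_bound[OF W]) simp
      ultimately show "norm (of_real (R t) * S (cis (- t))) \<le> R t"
        by (simp add: norm_mult mult_left_le)
    qed (use I[unfolded RS] J in \<open>blast intro: has_integral_integrable\<close>)+
    also have "integral {0..2*pi} R = 2 * pi" using J by (rule integral_unique)
    also have "integral {0..2*pi} (\<lambda>t. of_real (R t) * S (cis (- t))) = of_real (2 * pi) * ?f r"
      using integral_unique[OF I] unfolding RS
      by (simp add: distrib_left sum_distrib_left mult_ac del: power_Suc)
    finally have "2 * pi * norm (?f r) \<le> 2 * pi * 1"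
      by (simp only: norm_mult norm_of_real) simp
    thus ?thesis by (rule mult_left_le_imp_le) simp
  qed
  from norm_le_left_limit[of ?f, OF _ this] show ?thesis
    by (simp del: of_real_power power_Suc)
qed

subsection \<open>Schur parameters\<close>

text \<open>
  Here \<open>m\<close> and \<open>b\<close> are the first two Schur parameters, and \<open>B2\<close>, \<open>B3\<close> are solved for in terms of
  them. With \<open>c\<close> the third parameter, the right-hand side of \<open>N_poly_factor\<close> vanishes iff \<open>B4\<close>
  matches the \<open>\<omega>\<^sub>1\<^sup>4\<close> coefficient, so that \<open>c = N / (8 D)\<close>.
\<close>
context
  fixes x u m b y B2 B3 :: real
  assumes x: "x = 6 * u" and y: "y = 1 + m - u" and B2: "B2 = - 6 * u * (m + 3 * u)"
    and B3: "B3 = 2 * u\<^sup>2 * (1 + m + 3 * u) + 6 * u * (m + 3 * u)\<^sup>2 + 6 * u * b * (1 - m) * y"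
begin

lemma D_poly_factor: "D_poly x B2 B3 = 81 * x ^ 3 * (1 - m)\<^sup>2 * y\<^sup>2 * (1 - b\<^sup>2)"
  unfolding D_poly_def B3 B2 y x by algebra

lemma N_poly_factor:
  "N_poly x B2 B3 B4 - 648 * x ^ 3 * (1 - m)\<^sup>2 * y\<^sup>2 * (1 - b\<^sup>2) * c =
   - 108 * x\<^sup>2 * (1 - m) *
     ((1 + m) * (6 * B4 + 8 * x * B3 + 3 * B2\<^sup>2 + 6 * x\<^sup>2 * B2 + x ^ 4)
       - 6 * x * ((1 + m) * (1 - (1 + m) - 2 * y + 3 * y * (1 + m + (1 - m) * b))
          - y\<^sup>2 * ((1 + m)\<^sup>2 + (1 - m) * (3 * b + 2 * m * b - m * b\<^sup>2 + (1 - b\<^sup>2) * c))))"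
  unfolding N_poly_def B3 B2 y x by algebra

end

text \<open>The strict inequality forces \<open>d\<close> to be nonzero. This turns (C2) and (C3)
  into parameters \<open>b\<close> and \<open>c\<close> of modulus below 1.\<close>

lemma abs_quotient_less:
  fixes n d :: real
  assumes "\<bar>n\<bar> < k * \<bar>d\<bar>" "k > 0"
  obtains c where "\<bar>c\<bar> < 1" "n = k * d * c"
proof -
  have "d \<noteq> 0" using assms by auto
  thus ?thesis using assms by (intro that[of "n / (k * d)"]) (auto simp: abs_mult divide_simps)
qed

text \<open>The right-hand sides of the last four equations are the coefficients of
  \<open>w1 w3\<close>, \<open>w2^2\<close>, \<open>w1^2 w2\<close> and \<open>w1^4\<close> in
  \<open>20 a5\<close>; the left-hand sides are \<open>x\<close> times those in
  \<open>schwarz_quartic_bound\<close>. The equations determine \<open>r\<close>, \<open>m\<close>,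
  \<open>b\<close> and \<open>c\<close>, and (C4), (C1), (C2), (C3) put these, in this order, into
  the required ranges.\<close>

lemma coefficient_parameters:
  fixes x B2 B3 B4 :: real
  assumes x: "x > 0"
    and C1: "\<bar>x\<^sup>2 + 2 * B2\<bar> < 2 * x"
    and C2: "\<bar>x ^ 3 - x\<^sup>2 * B2 + 18 * B2\<^sup>2 - 18 * x * B3\<bar>
               < 3 * \<bar>(x\<^sup>2 + 2 * x + 2 * B2) * (2 * x\<^sup>2 - 3 * x + 3 * B2)\<bar>"
    and C3: "\<bar>N_poly x B2 B3 B4\<bar> < 8 * \<bar>D_poly x B2 B3\<bar>"
    and C4: "0 < (4 * x\<^sup>2 + 6 * (B2 - x)) / (3 * x\<^sup>2 + 6 * (B2 - x))"
            "(4 * x\<^sup>2 + 6 * (B2 - x)) / (3 * x\<^sup>2 + 6 * (B2 - x)) < 1"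
  obtains m b c r m2 m3 where
    "\<bar>m\<bar> < 1" "\<bar>b\<bar> < 1" "\<bar>c\<bar> < 1" "0 < r" "r < 1"
    "m2 = m\<^sup>2 + (1 - m\<^sup>2) * b"
    "m3 = m ^ 3 + 2 * m * (1 - m\<^sup>2) * b + (1 - m\<^sup>2) * ((1 - b\<^sup>2) * c - m * b\<^sup>2)"
    "x * (2 - 2 * (1 + m) * r) = 2 * B2 + 4 / 3 * x\<^sup>2"
    "x * (- m) = B2 + x\<^sup>2 / 2"
    "x * (3 - (1 + m) * (4 * r + 2) + 3 * (1 + 2 * m + m2) * r) = 3 * B3 + 11 / 3 * x * B2 + x ^ 3"
    "x * (1 - (1 + m) * (2 * r + 1) + 3 * (1 + 2 * m + m2) * r - (1 + 3 * m + 3 * m2 + m3) * r\<^sup>2)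
       = B4 + 4 / 3 * x * B3 + B2\<^sup>2 / 2 + x\<^sup>2 * B2 + x ^ 4 / 6"
proof -
  \<comment> \<open>The second equation forces this \<open>m\<close>. With \<open>u\<close> in place
    of \<open>x\<close>, both \<open>B2\<close> and \<open>B3\<close> become polynomials in the
    parameters with integer coefficients.\<close>
  define u m where "u = x / 6" and "m = - (x\<^sup>2 / 2 + B2) / x"
  define y where "y = 1 + m - u"
  define r where "r = y / (1 + m)"
  have xu: "x = 6 * u" and u: "u > 0" using x by (auto simp: u_def)
  have B2: "B2 = - 6 * u * (m + 3 * u)"
    using x by (simp add: m_def u_def field_simps power2_eq_square)
  have m: "\<bar>m\<bar> < 1"
    using C1 x unfolding m_def abs_divide by (simp add: divide_simps abs_mult)
  hence m': "1 + m > 0" "1 - m > 0" by auto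
  have "(4 * x\<^sup>2 + 6 * (B2 - x)) = - (6 * x) * y" "3 * x\<^sup>2 + 6 * (B2 - x) = - (6 * x) * (1 + m)"
    unfolding y_def xu B2 by algebra+
  hence "(4 * x\<^sup>2 + 6 * (B2 - x)) / (3 * x\<^sup>2 + 6 * (B2 - x)) = r"
    using x by (simp only: r_def) (subst mult_divide_mult_cancel_left, auto)
  hence r: "0 < r" "r < 1" using C4 by auto
  have yr: "y = (1 + m) * r" using m' by (simp add: r_def)
  hence y: "y > 0" using m' r by simp
  \<comment> \<open>In the new variables the product in (C2) is
    \<open>- 6 * x^2 * (1 - m) * y\<close>, so solving for \<open>B3\<close> gives an expression
    affine in \<open>b\<close>.\<close>
  obtain b where b: "\<bar>b\<bar> < 1" and b2: "x ^ 3 - x\<^sup>2 * B2 + 18 * B2\<^sup>2 - 18 * x * B3 =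
      3 * ((x\<^sup>2 + 2 * x + 2 * B2) * (2 * x\<^sup>2 - 3 * x + 3 * B2)) * b"
    using abs_quotient_less[OF C2] by auto
  have "18 * x * B3 = 18 * x * (2 * u\<^sup>2 * (1 + m + 3 * u) + 6 * u * (m + 3 * u)\<^sup>2 + 6 * u * b * (1 - m) * y)"
    using b2 unfolding y_def xu B2 by algebra
  hence B3: "B3 = 2 * u\<^sup>2 * (1 + m + 3 * u) + 6 * u * (m + 3 * u)\<^sup>2 + 6 * u * b * (1 - m) * y"
    using x by simp
  obtain c where c: "\<bar>c\<bar> < 1" and N: "N_poly x B2 B3 B4 = 8 * D_poly x B2 B3 * c"
    using abs_quotient_less[OF C3] by auto
  define m2 where "m2 = m\<^sup>2 + (1 - m\<^sup>2) * b"
  define m3 where "m3 = m ^ 3 + 2 * m * (1 - m\<^sup>2) * b + (1 - m\<^sup>2) * ((1 - b\<^sup>2) * c - m * b\<^sup>2)"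
  \<comment> \<open>As \<open>8 * 81 = 648\<close>, the choice of \<open>c\<close> makes the
    left-hand side of \<open>N_poly_factor\<close> vanish; the factor
    \<open>- 108 * x^2 * (1 - m)\<close> on its right is nonzero and drops out.\<close>
  have "N_poly x B2 B3 B4 - 648 * x ^ 3 * (1 - m)\<^sup>2 * y\<^sup>2 * (1 - b\<^sup>2) * c = 0"
    unfolding N D_poly_factor[OF xu y_def B2 B3] by simp
  hence R: "(1 + m) * (6 * B4 + 8 * x * B3 + 3 * B2\<^sup>2 + 6 * x\<^sup>2 * B2 + x ^ 4)
       = 6 * x * ((1 + m) * (1 - (1 + m) - 2 * y + 3 * y * (1 + m + (1 - m) * b))
          - y\<^sup>2 * ((1 + m)\<^sup>2 + (1 - m) * (3 * b + 2 * m * b - m * b\<^sup>2 + (1 - b\<^sup>2) * c)))"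
    unfolding N_poly_factor[OF xu y_def B2 B3] using x m' by simp
  \<comment> \<open>Substituting \<open>y = (1 + m) * r\<close> makes the common factor
    \<open>1 + m\<close> visible; it is positive and gets cancelled.\<close>
  have "(1 + m) * (6 * B4 + 8 * x * B3 + 3 * B2\<^sup>2 + 6 * x\<^sup>2 * B2 + x ^ 4) = (1 + m) * (6 * x *
      (1 - (1 + m) * (2 * r + 1) + 3 * (1 + 2 * m + m2) * r - (1 + 3 * m + 3 * m2 + m3) * r\<^sup>2))"
    unfolding R m2_def m3_def yr by algebra
  hence E4: "6 * B4 + 8 * x * B3 + 3 * B2\<^sup>2 + 6 * x\<^sup>2 * B2 + x ^ 4 = 6 * x *
      (1 - (1 + m) * (2 * r + 1) + 3 * (1 + 2 * m + m2) * r - (1 + 3 * m + 3 * m2 + m3) * r\<^sup>2)"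
    using m' by simp
  have rm: "(1 + m) * r = 1 + m - u" using yr by (simp add: y_def)
  show ?thesis
  proof (rule that[OF m b c r m2_def m3_def])
    have "3 * (x * (2 - 2 * (1 + m) * r)) = 6 * B2 + 4 * x\<^sup>2"
      using rm unfolding B2 xu by algebra
    thus "x * (2 - 2 * (1 + m) * r) = 2 * B2 + 4 / 3 * x\<^sup>2" by simp
    have "2 * (x * (- m)) = 2 * B2 + x\<^sup>2" unfolding B2 xu by algebra
    thus "x * (- m) = B2 + x\<^sup>2 / 2" by simp
    have "3 * (x * (3 - (1 + m) * (4 * r + 2) + 3 * (1 + 2 * m + m2) * r)) = 9 * B3 + 11 * x * B2 + 3 * x ^ 3"
      using rm unfolding B3 B2 xu y_def m2_def by algebra
    thus "x * (3 - (1 + m) * (4 * r + 2) + 3 * (1 + 2 * m + m2) * r) = 3 * B3 + 11 / 3 * x * B2 + x ^ 3"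
      by simp
    show "x * (1 - (1 + m) * (2 * r + 1) + 3 * (1 + 2 * m + m2) * r - (1 + 3 * m + 3 * m2 + m3) * r\<^sup>2)
       = B4 + 4 / 3 * x * B3 + B2\<^sup>2 / 2 + x\<^sup>2 * B2 + x ^ 4 / 6"
      using E4 by simp
  qed
qed

section \<open>Functions with prescribed Schur parameters\<close>

lemma blaschke_norm_less:
  fixes a :: real and w :: complex
  assumes a: "\<bar>a\<bar> < 1" and w: "norm w < 1"
  shows "1 + of_real a * w \<noteq> 0" "norm ((of_real a + w) / (1 + of_real a * w)) < 1"
proof -
  have "norm (of_real a * w) < 1"
    using a w mult_strict_mono'[of "\<bar>a\<bar>" 1 "norm w" 1] by (simp add: norm_mult)
  hence "1 - norm (of_real a * w) > 0" by simp
  moreover have "1 - norm (of_real a * w) \<le> norm (1 + of_real a * w)"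
    using norm_diff_ineq[of 1 "of_real a * w"] by simp
  ultimately show nz: "1 + of_real a * w \<noteq> 0" by auto
  have "(norm (1 + of_real a * w))\<^sup>2 - (norm (of_real a + w))\<^sup>2 = (1 - a\<^sup>2) * (1 - (norm w)\<^sup>2)"
    unfolding cmod_power2 by (simp add: power2_eq_square algebra_simps)
  moreover have "a\<^sup>2 < 1" "(norm w)\<^sup>2 < 1"
    using a w by (simp_all add: abs_square_less_1 power_less_one_iff)
  ultimately have "(norm (of_real a + w))\<^sup>2 < (norm (1 + of_real a * w))\<^sup>2"
    by (smt (verit) mult_pos_pos)
  hence "norm (of_real a + w) < norm (1 + of_real a * w)"
    by (rule power2_less_imp_less) simp
  thus "norm ((of_real a + w) / (1 + of_real a * w)) < 1"
    using nz by (simp add: norm_divide)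
qed

text \<open>One backward step of the Schur algorithm: \<open>T\<close> is the image of
  \<open>z * S z\<close> under the disc automorphism sending 0 to \<open>a\<close>, so
  \<open>a\<close> becomes the first Schur parameter and those of \<open>S\<close> follow.\<close>

lemma schur_step:
  fixes a :: real
  assumes a: "\<bar>a\<bar> < 1" and S: "S holomorphic_on unit_disc"
    and Sn: "\<And>z. z \<in> unit_disc \<Longrightarrow> norm (S z) < 1"
  obtains T where "T holomorphic_on unit_disc" "\<And>z. z \<in> unit_disc \<Longrightarrow> norm (T z) < 1"
    "taylor_coeff T 0 = of_real a"
    "taylor_coeff T 1 = of_real (1 - a\<^sup>2) * taylor_coeff S 0"
    "taylor_coeff T 2 = of_real (1 - a\<^sup>2) * (taylor_coeff S 1 - of_real a * (taylor_coeff S 0)\<^sup>2)"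
proof -
  define T where "T = (\<lambda>z. (of_real a + z * S z) / (1 + of_real a * (z * S z)))"
  have zS: "norm (z * S z) < 1" if "z \<in> unit_disc" for z
    using that Sn[OF that] mult_strict_mono'[of "norm z" 1 "norm (S z)" 1] by (simp add: norm_mult)
  note nz = blaschke_norm_less(1)[OF a zS]
  have T: "T holomorphic_on unit_disc"
    unfolding T_def using nz by (intro holomorphic_intros S) auto
  define F G where "F = fps_expansion T 0" and "G = fps_expansion S 0"
  \<comment> \<open>Clearing the denominator gives a recursion: because of the factor
    \<open>fps_X\<close>, each coefficient of \<open>F\<close> depends only on earlier ones of
    \<open>F\<close>.\<close>
  have "F = fps_const (of_real a) + fps_X * (G - fps_const (of_real a) * (G * F))"
  proof (rule fps_eq_of_eq_on_disc)
    show "T has_fps_expansion F" unfolding F_def by (rule fps_expansion_of_holomorphic[OF T])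
    show "(\<lambda>z. of_real a + z * (S z - of_real a * (S z * T z))) has_fps_expansion
            fps_const (of_real a) + fps_X * (G - fps_const (of_real a) * (G * F))"
      unfolding F_def G_def
      by (intro fps_expansion_intros fps_expansion_of_holomorphic S T)
    show "T z = of_real a + z * (S z - of_real a * (S z * T z))" if "z \<in> unit_disc" for z
      using nz[OF that] by (simp add: T_def field_simps)
  qed
  hence nth: "fps_nth F n =
      fps_nth (fps_const (of_real a) + fps_X * (G - fps_const (of_real a) * (G * F))) n" for n
    by (rule arg_cong)
  have F0: "fps_nth F 0 = of_real a" by (subst nth) simp
  have F1: "fps_nth F 1 = of_real (1 - a\<^sup>2) * fps_nth G 0"
    by (subst nth) (simp add: F0 algebra_simps power2_eq_square)
  have F2: "fps_nth F 2 = of_real (1 - a\<^sup>2) * (fps_nth G 1 - of_real a * (fps_nth G 0)\<^sup>2)"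
    using F1 by (subst nth) (simp add: F0 fps_mult_nth_1', simp add: algebra_simps power2_eq_square)
  show ?thesis
    using that[OF T _ F0[unfolded F_def] F1[unfolded F_def G_def] F2[unfolded F_def G_def]]
      blaschke_norm_less(2)[OF a zS] by (simp add: T_def)
qed

text \<open>Two backward Schur steps from the constant \<open>c\<close>, with parameters
  \<open>b\<close> and then \<open>m\<close>, and finally the Cayley transform of
  \<open>z * T z\<close>. The halved coefficients of \<open>h\<close> are the weights that enter
  \<open>livingston_coeff_bound\<close>.\<close>

lemma caratheodory_of_schur_parameters:
  fixes m b c :: real
  assumes "\<bar>m\<bar> < 1" "\<bar>b\<bar> < 1" "\<bar>c\<bar> < 1"
  obtains h where "h holomorphic_on unit_disc" "\<And>z. z \<in> unit_disc \<Longrightarrow> Re (h z) > 0" "h 0 = 1"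
    "taylor_coeff h 1 = 2 * of_real m"
    "taylor_coeff h 2 = 2 * of_real (m\<^sup>2 + (1 - m\<^sup>2) * b)"
    "taylor_coeff h 3 =
       2 * of_real (m ^ 3 + 2 * m * (1 - m\<^sup>2) * b + (1 - m\<^sup>2) * ((1 - b\<^sup>2) * c - m * b\<^sup>2))"
proof -
  have "taylor_coeff (\<lambda>_. of_real c) 0 = of_real c" by (simp add: fps_expansion_def)
  moreover obtain S where S: "S holomorphic_on unit_disc" "\<And>z. z \<in> unit_disc \<Longrightarrow> norm (S z) < 1"
    "taylor_coeff S 0 = of_real b"
    "taylor_coeff S 1 = of_real (1 - b\<^sup>2) * taylor_coeff (\<lambda>_. of_real c) 0"
    using schur_step[OF assms(2), of "\<lambda>_. of_real c"] assms(3) by auto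
  moreover obtain T where T: "T holomorphic_on unit_disc" "\<And>z. z \<in> unit_disc \<Longrightarrow> norm (T z) < 1"
    "taylor_coeff T 0 = of_real m"
    "taylor_coeff T 1 = of_real (1 - m\<^sup>2) * taylor_coeff S 0"
    "taylor_coeff T 2 = of_real (1 - m\<^sup>2) * (taylor_coeff S 1 - of_real m * (taylor_coeff S 0)\<^sup>2)"
    using schur_step[OF assms(1) S(1,2)] by blast
  ultimately have T1: "taylor_coeff T 1 = of_real ((1 - m\<^sup>2) * b)"
    and T2: "taylor_coeff T 2 = of_real ((1 - m\<^sup>2) * ((1 - b\<^sup>2) * c - m * b\<^sup>2))"
    by simp_all
  define h where "h = (\<lambda>z. (1 + z * T z) / (1 - z * T z))"
  have zT: "norm (z * T z) < 1" if "z \<in> unit_disc" for z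
    using that T(2)[OF that] mult_strict_mono'[of "norm z" 1 "norm (T z)" 1] by (simp add: norm_mult)
  hence nz: "1 - z * T z \<noteq> 0" if "z \<in> unit_disc" for z using that by fastforce
  have h: "h holomorphic_on unit_disc"
    unfolding h_def using nz by (intro holomorphic_intros T(1)) auto
  define F G where "F = fps_expansion h 0" and "G = fps_expansion T 0"
  have "F = 1 + fps_X * (G + G * F)"
  proof (rule fps_eq_of_eq_on_disc)
    show "h has_fps_expansion F" unfolding F_def by (rule fps_expansion_of_holomorphic[OF h])
    show "(\<lambda>z. 1 + z * (T z + T z * h z)) has_fps_expansion 1 + fps_X * (G + G * F)"
      unfolding F_def G_def by (intro fps_expansion_intros fps_expansion_of_holomorphic h T(1))
    show "h z = 1 + z * (T z + T z * h z)" if "z \<in> unit_disc" for z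
      using nz[OF that] by (simp add: h_def field_simps)
  qed
  hence nth: "fps_nth F n = fps_nth (1 + fps_X * (G + G * F)) n" for n
    by (rule arg_cong)
  have F0: "fps_nth F 0 = 1" by (subst nth) simp
  have F1: "fps_nth F 1 = 2 * fps_nth G 0"
    by (subst nth) (simp add: F0)
  have F2: "fps_nth F 2 = 2 * (fps_nth G 1 + (fps_nth G 0)\<^sup>2)"
    using F1 by (subst nth) (simp add: F0 fps_mult_nth_1', simp add: algebra_simps power2_eq_square)
  have F3: "fps_nth F 3 = 2 * (fps_nth G 2 + 2 * fps_nth G 0 * fps_nth G 1 + fps_nth G 0 ^ 3)"
    using F1 F2 by (subst nth)
      (simp add: F0, simp add: F0 fps_mult_nth numeral_2_eq_2 algebra_simps power2_eq_square power3_eq_cube)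
  show ?thesis
  proof (rule that[OF h])
    show "Re (h z) > 0" if "z \<in> unit_disc" for z
      unfolding h_def by (rule cayley_Re_pos[OF zT[OF that]])
    show "taylor_coeff h 1 = 2 * of_real m"
      using F1 T(3) by (simp add: F_def G_def)
    show "taylor_coeff h 2 = 2 * of_real (m\<^sup>2 + (1 - m\<^sup>2) * b)"
      using F2 T(3) T1 by (simp add: F_def G_def)
    show "taylor_coeff h 3 =
       2 * of_real (m ^ 3 + 2 * m * (1 - m\<^sup>2) * b + (1 - m\<^sup>2) * ((1 - b\<^sup>2) * c - m * b\<^sup>2))"
      using F3 T(3) T1 T2 by (simp add: F_def G_def)
  qed (simp add: h_def)
qed

section \<open>Averaging over \<open>z\<close> and \<open>- z\<close>, and the resulting quartic
  bound\<close>

text \<open>A convex combination of \<open>p z\<close> and \<open>p (- z)\<close> keeps the positive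
  real part and the even coefficients, while the odd ones are multiplied by \<open>s\<close>. Its
  inverse Cayley transform is \<open>W\<close>, and \<open>Q\<close> is its power series.\<close>

lemma schwarz_of_averaged_caratheodory:
  fixes s :: real
  assumes p: "p holomorphic_on unit_disc" and Re: "\<And>z. z \<in> unit_disc \<Longrightarrow> Re (p z) > 0"
    and p0: "p 0 = 1" and s: "\<bar>s\<bar> \<le> 1"
  obtains W Q where "schwarz_function W"
    "\<And>n. fps_nth Q n = (if even n then 1 else of_real s) * taylor_coeff p n"
    "fps_expansion W 0 * (1 + Q) = Q - 1"
proof -
  define q where "q = (\<lambda>z. of_real ((1 + s) / 2) * p z + of_real ((1 - s) / 2) * p (- z))"
  define W where "W = (\<lambda>z. (q z - 1) / (1 + q z))"
  have "uminus holomorphic_on unit_disc"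
    using holomorphic_on_minus[OF holomorphic_on_ident] by simp
  hence "(p \<circ> uminus) holomorphic_on unit_disc"
    by (rule holomorphic_on_compose_gen[OF _ p]) auto
  hence holm: "(\<lambda>z. p (- z)) holomorphic_on unit_disc"
    by (simp add: o_def)
  have holq: "q holomorphic_on unit_disc"
    unfolding q_def by (intro holomorphic_intros p holm)
  have Re_q: "Re (q z) > 0" if z: "z \<in> unit_disc" for z
  proof -
    have "Re (q z) = (1 + s) / 2 * Re (p z) + (1 - s) / 2 * Re (p (- z))"
      by (simp add: q_def)
    moreover have "Re (p z) > 0" "Re (p (- z)) > 0" using z by (auto intro!: Re)
    moreover have "(1 + s) / 2 \<ge> 0" "(1 - s) / 2 \<ge> 0" "(1 + s) / 2 + (1 - s) / 2 = 1"
      using s by (auto simp: field_simps)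
    ultimately show ?thesis
      by (smt (verit) mult_nonneg_nonneg mult_pos_pos)
  qed
  have nz: "1 + q z \<noteq> 0" if "z \<in> unit_disc" for z
  proof
    assume "1 + q z = 0"
    hence "Re (1 + q z) = 0" by simp
    thus False using Re_q[OF that] by simp
  qed
  have holW: "W holomorphic_on unit_disc"
    unfolding W_def using nz by (intro holomorphic_intros holq) auto
  have "norm (W z) < 1" if "z \<in> unit_disc" for z
  proof -
    have "(norm (1 + q z))\<^sup>2 - (norm (q z - 1))\<^sup>2 = 4 * Re (q z)"
      unfolding cmod_power2 by (simp add: power2_eq_square algebra_simps)
    hence "(norm (q z - 1))\<^sup>2 < (norm (1 + q z))\<^sup>2" using Re_q[OF that] by simp
    hence "norm (q z - 1) < norm (1 + q z)" by (rule power2_less_imp_less) simp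
    thus ?thesis using nz[OF that] by (simp add: W_def norm_divide)
  qed
  moreover have "W 0 = 0"
    by (simp add: W_def q_def p0 add_divide_distrib diff_divide_distrib)
  ultimately have W: "schwarz_function W" using holW by (auto simp: schwarz_function_def)
  define P where "P = fps_expansion p 0"
  define Q where "Q = fps_const (of_real ((1 + s) / 2)) * P + fps_const (of_real ((1 - s) / 2)) * (P oo (- fps_X))"
  have P: "p has_fps_expansion P" unfolding P_def by (rule fps_expansion_of_holomorphic[OF p])
  have "(p \<circ> (\<lambda>z. - z)) has_fps_expansion (P oo (- fps_X))"
    by (rule has_fps_expansion_compose[OF P]) (auto intro: fps_expansion_intros)
  hence Q: "q has_fps_expansion Q"
    unfolding q_def Q_def by (intro fps_expansion_intros P) (simp add: o_def)
  have "fps_nth Q n = (if even n then 1 else of_real s) * taylor_coeff p n" for n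
    by (simp add: Q_def P_def fps_compose_uminus' algebra_simps add_divide_distrib diff_divide_distrib)
  moreover have "fps_expansion W 0 * (1 + Q) = Q - 1"
  proof (rule fps_eq_of_eq_on_disc)
    show "(\<lambda>z. W z * (1 + q z)) has_fps_expansion fps_expansion W 0 * (1 + Q)"
      by (intro fps_expansion_intros fps_expansion_of_holomorphic holW Q)
    show "(\<lambda>z. q z - 1) has_fps_expansion Q - 1" by (intro fps_expansion_intros Q)
  qed (use nz in \<open>auto simp: W_def\<close>)
  ultimately show ?thesis using that[OF W] by blast
qed

text \<open>As \<open>F = (Q - 1) / (Q + 1)\<close>, the coefficients of \<open>F\<close> up to
  order 4 are polynomials in those of \<open>Q\<close>; the factor 16 clears their
  denominators.\<close>

lemma fps_cayley_combination:
  fixes F Q :: "complex fps" and m1 m2 m3 :: complex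
  assumes F: "F * (1 + Q) = Q - 1" and Q0: "fps_nth Q 0 = 1"
  shows "16 * (fps_nth F 4 - m1 * fps_nth (F ^ 2) 4 + m2 * fps_nth (F ^ 3) 4 - m3 * fps_nth (F ^ 4) 4) =
    8 * fps_nth Q 4 - 4 * (1 + m1) * (2 * fps_nth Q 1 * fps_nth Q 3 + (fps_nth Q 2)\<^sup>2)
      + 6 * (1 + 2 * m1 + m2) * (fps_nth Q 1)\<^sup>2 * fps_nth Q 2
      - (1 + 3 * m1 + 3 * m2 + m3) * fps_nth Q 1 ^ 4"
proof -
  define q1 q2 q3 q4 where "q1 = fps_nth Q 1" and "q2 = fps_nth Q 2" and "q3 = fps_nth Q 3"
    and "q4 = fps_nth Q 4"
  define f1 f2 f3 f4 where "f1 = fps_nth F 1" and "f2 = fps_nth F 2" and "f3 = fps_nth F 3"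
    and "f4 = fps_nth F 4"
  note defs = q1_def q2_def q3_def q4_def f1_def f2_def f3_def f4_def
  have nth: "fps_nth (F * (1 + Q)) n = fps_nth (Q - 1) n" for n using F by simp
  have F0: "fps_nth F 0 = 0" using nth[of 0] Q0 by simp
  have f: "2 * f1 = q1" "2 * f2 + f1 * q1 = q2" "2 * f3 + f1 * q2 + f2 * q1 = q3"
      "2 * f4 + f1 * q3 + f2 * q2 + f3 * q1 = q4"
    using nth[of 1] nth[of 2] nth[of 3] nth[of 4] Q0 F0
    by (simp_all add: defs fps_mult_nth eval_nat_numeral algebra_simps)
  have sq: "fps_nth (F ^ 2) 4 = 2 * f1 * f3 + f2\<^sup>2" "fps_nth (F ^ 2) 3 = 2 * f1 * f2"
      "fps_nth (F ^ 2) 2 = f1\<^sup>2" "fps_nth (F ^ 2) 1 = 0" "fps_nth (F ^ 2) 0 = 0"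
    by (simp_all add: defs power2_eq_square fps_mult_nth eval_nat_numeral F0)
  have "fps_nth (F * F ^ 2) 4 = 3 * f1\<^sup>2 * f2" "fps_nth (F ^ 2 * F ^ 2) 4 = f1 ^ 4"
    unfolding fps_mult_nth using sq
    by (simp_all add: F0 defs eval_nat_numeral algebra_simps)
  moreover have "F ^ 3 = F * F ^ 2" "F ^ 4 = F ^ 2 * F ^ 2"
    by (simp_all add: eval_nat_numeral mult.assoc)
  ultimately have pw: "fps_nth (F ^ 3) 4 = 3 * f1\<^sup>2 * f2" "fps_nth (F ^ 4) 4 = f1 ^ 4" by (simp_all only:)
  \<comment> \<open>Each \<open>q\<close> is expressed through the \<open>f\<close>, not conversely,
    so that no division remains.\<close>
  have "16 * (f4 - m1 * (2 * f1 * f3 + f2\<^sup>2) + m2 * (3 * f1\<^sup>2 * f2) - m3 * f1 ^ 4) =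
    8 * q4 - 4 * (1 + m1) * (2 * q1 * q3 + q2\<^sup>2) + 6 * (1 + 2 * m1 + m2) * q1\<^sup>2 * q2
      - (1 + 3 * m1 + 3 * m2 + m3) * q1 ^ 4"
    unfolding f[symmetric] by algebra
  thus ?thesis unfolding sq pw by (simp only: defs)
qed

text \<open>The \<open>p\<close> are the coefficients of
  \<open>(1 + \<omega>) / (1 - \<omega>)\<close>. Every monomial has total index 4, so the odd-index
  factors, the only ones scaled by \<open>s\<close>, occur in even number and only
  \<open>s^2 = r\<close> survives.\<close>

lemma averaged_quartic_identity:
  fixes s r m m2 m3 w1 w2 w3 w4 p1 p2 p3 p4 :: complex
  assumes s: "s\<^sup>2 = r"
    and p: "p1 = 2 * w1" "p2 = 2 * w2 + p1 * w1" "p3 = 2 * w3 + p1 * w2 + p2 * w1"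
      "p4 = 2 * w4 + p1 * w3 + p2 * w2 + p3 * w1"
  shows "8 * p4 - 4 * (1 + m) * (2 * (s * p1) * (s * p3) + p2\<^sup>2)
      + 6 * (1 + 2 * m + m2) * (s * p1)\<^sup>2 * p2 - (1 + 3 * m + 3 * m2 + m3) * (s * p1) ^ 4 =
    16 * (w4 + (2 - 2 * (1 + m) * r) * (w1 * w3) + - m * w2\<^sup>2
      + (3 - (1 + m) * (4 * r + 2) + 3 * (1 + 2 * m + m2) * r) * (w1\<^sup>2 * w2)
      + (1 - (1 + m) * (2 * r + 1) + 3 * (1 + 2 * m + m2) * r - (1 + 3 * m + 3 * m2 + m3) * r\<^sup>2) * w1 ^ 4)"
  unfolding p s[symmetric] by algebra

text \<open>\<open>livingston_coeff_bound\<close> controls the fourth coefficient of a combination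
  of powers of \<open>W\<close>; the two preceding identities rewrite it in the coefficients of
  \<omega>, which is where the unwieldy factors come from.\<close>

lemma schwarz_quartic_bound:
  fixes m b c r m2 m3 :: real
  assumes \<omega>: "schwarz_function \<omega>"
    and par: "\<bar>m\<bar> < 1" "\<bar>b\<bar> < 1" "\<bar>c\<bar> < 1" "0 \<le> r" "r \<le> 1"
    and m2: "m2 = m\<^sup>2 + (1 - m\<^sup>2) * b"
    and m3: "m3 = m ^ 3 + 2 * m * (1 - m\<^sup>2) * b + (1 - m\<^sup>2) * ((1 - b\<^sup>2) * c - m * b\<^sup>2)"
  defines "w \<equiv> taylor_coeff \<omega>"
  shows "norm (w 4 + of_real (2 - 2 * (1 + m) * r) * (w 1 * w 3) + of_real (- m) * (w 2)\<^sup>2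
      + of_real (3 - (1 + m) * (4 * r + 2) + 3 * (1 + 2 * m + m2) * r) * ((w 1)\<^sup>2 * w 2)
      + of_real (1 - (1 + m) * (2 * r + 1) + 3 * (1 + 2 * m + m2) * r
          - (1 + 3 * m + 3 * m2 + m3) * r\<^sup>2) * w 1 ^ 4) \<le> 1"
proof -
  define s where "s = sqrt r"
  have s: "\<bar>s\<bar> \<le> 1" "s\<^sup>2 = r" using par by (auto simp: s_def)
  have hol: "\<omega> holomorphic_on unit_disc" and n: "\<And>z. z \<in> unit_disc \<Longrightarrow> norm (\<omega> z) < 1"
    and \<omega>0: "\<omega> 0 = 0"
    using \<omega> by (auto simp: schwarz_function_def)
  define p where "p = (\<lambda>z. (1 + \<omega> z) / (1 - \<omega> z))"
  have nz: "1 - \<omega> z \<noteq> 0" if "z \<in> unit_disc" for z using n[OF that] by fastforce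
  have p: "p holomorphic_on unit_disc"
    unfolding p_def using nz by (intro holomorphic_intros hol) auto
  have Re: "Re (p z) > 0" if "z \<in> unit_disc" for z
    unfolding p_def by (rule cayley_Re_pos[OF n[OF that]])
  have p0: "p 0 = 1" by (simp add: p_def \<omega>0)
  obtain W Q where W: "schwarz_function W"
    and Qn: "\<And>n. fps_nth Q n = (if even n then 1 else of_real s) * taylor_coeff p n"
    and WQ: "fps_expansion W 0 * (1 + Q) = Q - 1"
    using schwarz_of_averaged_caratheodory[OF p Re p0 s(1)] by blast
  obtain h where h: "h holomorphic_on unit_disc" "\<And>z. z \<in> unit_disc \<Longrightarrow> Re (h z) > 0" "h 0 = 1"
    "taylor_coeff h 1 = 2 * of_real m" "taylor_coeff h 2 = 2 * of_real m2"
    "taylor_coeff h 3 = 2 * of_real m3"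
    using caratheodory_of_schur_parameters[OF par(1-3)] unfolding m2 m3 by blast
  define F where "F = fps_expansion W 0"
  have bound: "norm (fps_nth F 4 - of_real m * fps_nth (F ^ 2) 4 + of_real m2 * fps_nth (F ^ 3) 4
          - of_real m3 * fps_nth (F ^ 4) 4) \<le> 1"
  proof -
    \<comment> \<open>The case \<open>N = 3\<close> concerns the fourth coefficient; these facts
      expand the sum and turn successors into numerals.\<close>
    have "(\<Sum>k<3. f k) = f 0 + f 1 + f 2" for f :: "nat \<Rightarrow> complex"
      by (simp add: eval_nat_numeral)
    moreover have "Suc 0 = 1" "Suc 1 = 2" "Suc 2 = 3" "Suc 3 = 4" by simp_all
    moreover have "norm (fps_nth (F ^ Suc 0) (Suc 3) + (\<Sum>k<3. (- 1) ^ Suc k * (taylor_coeff h (Suc k) / 2) * fps_nth (F ^ Suc (Suc k)) (Suc 3))) \<le> 1"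
      unfolding F_def by (rule livingston_coeff_bound[OF h(1) less_imp_le[OF h(2)] h(3) W])
    ultimately have "norm (fps_nth (F ^ 1) 4 + ((- 1) ^ 1 * (taylor_coeff h 1 / 2) * fps_nth (F ^ 2) 4
        + (- 1) ^ 2 * (taylor_coeff h 2 / 2) * fps_nth (F ^ 3) 4
        + (- 1) ^ 3 * (taylor_coeff h 3 / 2) * fps_nth (F ^ 4) 4)) \<le> 1"
      by (simp only:)
    thus ?thesis unfolding h(4-6) by (simp add: power3_eq_cube add_diff_eq diff_add_eq)
  qed
  have P: "fps_expansion p 0 * (1 - fps_expansion \<omega> 0) = 1 + fps_expansion \<omega> 0"
  proof (rule fps_eq_of_eq_on_disc)
    show "(\<lambda>z. p z * (1 - \<omega> z)) has_fps_expansion fps_expansion p 0 * (1 - fps_expansion \<omega> 0)"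
      by (intro fps_expansion_intros fps_expansion_of_holomorphic p hol)
    show "(\<lambda>z. 1 + \<omega> z) has_fps_expansion 1 + fps_expansion \<omega> 0"
      by (intro fps_expansion_intros fps_expansion_of_holomorphic hol)
  qed (use nz in \<open>auto simp: p_def\<close>)
  define P' where "P' = fps_expansion p 0"
  define w' where "w' = fps_expansion \<omega> 0"
  have w: "w n = fps_nth w' n" for n by (simp add: w_def w'_def)
  have w0: "fps_nth w' 0 = 0" by (simp add: w'_def taylor_coeff_0 \<omega>0)
  have P0: "fps_nth P' 0 = 1" by (simp add: P'_def taylor_coeff_0 p0)
  have nth: "fps_nth (P' * (1 - w')) n = fps_nth (1 + w') n" for n
    using P by (simp add: P'_def w'_def)
  have Ps: "fps_nth P' 1 = 2 * w 1" "fps_nth P' 2 = 2 * w 2 + fps_nth P' 1 * w 1"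
    "fps_nth P' 3 = 2 * w 3 + fps_nth P' 1 * w 2 + fps_nth P' 2 * w 1"
    "fps_nth P' 4 = 2 * w 4 + fps_nth P' 1 * w 3 + fps_nth P' 2 * w 2 + fps_nth P' 3 * w 1"
    using nth[of 1] nth[of 2] nth[of 3] nth[of 4] P0 w0
    by (simp_all add: w fps_mult_nth eval_nat_numeral algebra_simps)
  have Q: "fps_nth Q 0 = 1" "fps_nth Q 1 = of_real s * fps_nth P' 1" "fps_nth Q 2 = fps_nth P' 2"
    "fps_nth Q 3 = of_real s * fps_nth P' 3" "fps_nth Q 4 = fps_nth P' 4"
    using P0 by (simp_all add: Qn P'_def)
  have sr: "(of_real s :: complex)\<^sup>2 = of_real r" using s(2) by (simp flip: of_real_power)
  have "16 * (fps_nth F 4 - of_real m * fps_nth (F ^ 2) 4 + of_real m2 * fps_nth (F ^ 3) 4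
          - of_real m3 * fps_nth (F ^ 4) 4) = 16 *
     (w 4 + of_real (2 - 2 * (1 + m) * r) * (w 1 * w 3) + of_real (- m) * (w 2)\<^sup>2
      + of_real (3 - (1 + m) * (4 * r + 2) + 3 * (1 + 2 * m + m2) * r) * ((w 1)\<^sup>2 * w 2)
      + of_real (1 - (1 + m) * (2 * r + 1) + 3 * (1 + 2 * m + m2) * r
          - (1 + 3 * m + 3 * m2 + m3) * r\<^sup>2) * w 1 ^ 4)"
    (is "16 * ?X = 16 * ?Y")
    unfolding fps_cayley_combination[OF WQ[folded F_def] Q(1)] Q(2-5)
      averaged_quartic_identity[OF sr Ps]
    by (simp only: of_real_diff of_real_add of_real_mult of_real_1 of_real_numeral of_real_minus of_real_power)
  hence "?X = ?Y" by (rule mult_left_cancel[THEN iffD1, rotated]) simp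
  with bound show ?thesis by (simp only:)
qed

subsection \<open>The fifth coefficient\<close>

lemma fps_compose_coeffs:
  fixes F W :: "complex fps"
  assumes W0: "fps_nth W 0 = 0"
  defines "w \<equiv> fps_nth W" and "\<beta> \<equiv> fps_nth F"
  shows "fps_nth (F oo W) 1 = \<beta> 1 * w 1"
    "fps_nth (F oo W) 2 = \<beta> 1 * w 2 + \<beta> 2 * (w 1)\<^sup>2"
    "fps_nth (F oo W) 3 = \<beta> 1 * w 3 + \<beta> 2 * (2 * w 1 * w 2) + \<beta> 3 * w 1 ^ 3"
    "fps_nth (F oo W) 4 = \<beta> 1 * w 4 + \<beta> 2 * (2 * w 1 * w 3 + (w 2)\<^sup>2) + \<beta> 3 * (3 * (w 1)\<^sup>2 * w 2) + \<beta> 4 * w 1 ^ 4"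
  by (simp_all add: fps_compose_nth w_def \<beta>_def fps_mult_nth eval_nat_numeral W0 algebra_simps)

text \<open>Multiplied by f', the relation reads
  \<open>z f'' = f' (\<phi> \<circ> \<omega> - 1)\<close>; comparing coefficients up to order 4
  determines \<open>a5\<close>. The factor 120 clears the denominators.\<close>

lemma fifth_coefficient:
  assumes f: "f holomorphic_on unit_disc" and f1: "taylor_coeff f 1 = 1"
    and f': "\<And>z. z \<in> unit_disc \<Longrightarrow> deriv f z \<noteq> 0"
    and \<phi>: "\<phi> holomorphic_on unit_disc" and \<phi>0: "\<phi> 0 = 1"
    and \<omega>: "schwarz_function \<omega>"
    and eq: "\<And>z. z \<in> unit_disc \<Longrightarrow> 1 + z * deriv (deriv f) z / deriv f z = \<phi> (\<omega> z)"
  defines "w \<equiv> taylor_coeff \<omega>" and "\<beta> \<equiv> taylor_coeff \<phi>"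
  shows "120 * taylor_coeff f 5 = 6 * \<beta> 1 * w 4 + (12 * \<beta> 2 + 8 * (\<beta> 1)\<^sup>2) * (w 1 * w 3)
     + (6 * \<beta> 2 + 3 * (\<beta> 1)\<^sup>2) * (w 2)\<^sup>2
     + (18 * \<beta> 3 + 22 * \<beta> 1 * \<beta> 2 + 6 * \<beta> 1 ^ 3) * ((w 1)\<^sup>2 * w 2)
     + (6 * \<beta> 4 + 8 * \<beta> 1 * \<beta> 3 + 3 * (\<beta> 2)\<^sup>2 + 6 * (\<beta> 1)\<^sup>2 * \<beta> 2 + \<beta> 1 ^ 4) * w 1 ^ 4"
proof -
  have hol\<omega>: "\<omega> holomorphic_on unit_disc" and \<omega>0: "\<omega> 0 = 0"
    using \<omega> by (auto simp: schwarz_function_def)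
  define A where "A = fps_expansion f 0"
  define F where "F = fps_expansion \<phi> 0"
  define W where "W = fps_expansion \<omega> 0"
  define G where "G = F oo W"
  have W0: "fps_nth W 0 = 0" by (simp add: W_def taylor_coeff_0 \<omega>0)
  have G0: "fps_nth G 0 = 1" by (simp add: G_def F_def taylor_coeff_0 \<phi>0)
  have A: "f has_fps_expansion A"
    unfolding A_def by (rule fps_expansion_of_holomorphic[OF f])
  have "fps_X * fps_deriv (fps_deriv A) = fps_deriv A * (G - 1)"
  proof (rule fps_eq_of_eq_on_disc)
    show "(\<lambda>z. z * deriv (deriv f) z) has_fps_expansion fps_X * fps_deriv (fps_deriv A)"
      by (intro fps_expansion_intros A)
    have "(\<phi> \<circ> \<omega>) has_fps_expansion G"
      unfolding G_def F_def W_def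
      by (intro has_fps_expansion_compose fps_expansion_of_holomorphic \<phi> hol\<omega>)
         (use W0 in \<open>simp add: W_def\<close>)
    thus "(\<lambda>z. deriv f z * (\<phi> (\<omega> z) - 1)) has_fps_expansion fps_deriv A * (G - 1)"
      by (intro fps_expansion_intros A) (simp add: o_def)
    show "z * deriv (deriv f) z = deriv f z * (\<phi> (\<omega> z) - 1)" if "z \<in> unit_disc" for z
      using eq[OF that, symmetric] f'[OF that] by simp
  qed
  hence nth: "fps_nth (fps_X * fps_deriv (fps_deriv A)) n = fps_nth (fps_deriv A * (G - 1)) n" for n
    by simp
  define g1 g2 g3 g4 where "g1 = fps_nth G 1" and "g2 = fps_nth G 2" and "g3 = fps_nth G 3"
    and "g4 = fps_nth G 4"
  define a2 a3 a4 a5 where "a2 = fps_nth A 2" and "a3 = fps_nth A 3" and "a4 = fps_nth A 4"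
    and "a5 = fps_nth A 5"
  note defs = g1_def g2_def g3_def g4_def a2_def a3_def a4_def a5_def
  have A1: "fps_nth A 1 = 1" using f1 by (simp add: A_def)
  have "2 * a2 = g1" "6 * a3 = 2 * a2 * g1 + g2" "12 * a4 = 3 * a3 * g1 + 2 * a2 * g2 + g3"
    "20 * a5 = 4 * a4 * g1 + 3 * a3 * g2 + 2 * a2 * g3 + g4"
    using nth[of 1] nth[of 2] nth[of 3] nth[of 4] A1 G0
    by (simp_all add: defs fps_mult_nth eval_nat_numeral algebra_simps)
  \<comment> \<open>Solved for the \<open>g\<close> rather than the \<open>a\<close>, so that the
    formula for \<open>120 * a5\<close> is checked without division.\<close>
  hence g: "g1 = 2 * a2" "g2 = 6 * a3 - 2 * a2 * g1" "g3 = 12 * a4 - 3 * a3 * g1 - 2 * a2 * g2"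
    "g4 = 20 * a5 - 4 * a4 * g1 - 3 * a3 * g2 - 2 * a2 * g3"
    by (simp_all add: algebra_simps)
  have "120 * a5 = 6 * g4 + 8 * g1 * g3 + 3 * g2\<^sup>2 + 6 * g1\<^sup>2 * g2 + g1 ^ 4"
    unfolding g by algebra
  moreover have "g1 = \<beta> 1 * w 1" "g2 = \<beta> 1 * w 2 + \<beta> 2 * (w 1)\<^sup>2"
    "g3 = \<beta> 1 * w 3 + \<beta> 2 * (2 * w 1 * w 2) + \<beta> 3 * w 1 ^ 3"
    "g4 = \<beta> 1 * w 4 + \<beta> 2 * (2 * w 1 * w 3 + (w 2)\<^sup>2) + \<beta> 3 * (3 * (w 1)\<^sup>2 * w 2) + \<beta> 4 * w 1 ^ 4"
    using fps_compose_coeffs[OF W0, of F]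
    by (simp_all only: g1_def g2_def g3_def g4_def G_def F_def W_def w_def \<beta>_def)
  ultimately have "120 * a5 = 6 * \<beta> 1 * w 4 + (12 * \<beta> 2 + 8 * (\<beta> 1)\<^sup>2) * (w 1 * w 3)
     + (6 * \<beta> 2 + 3 * (\<beta> 1)\<^sup>2) * (w 2)\<^sup>2
     + (18 * \<beta> 3 + 22 * \<beta> 1 * \<beta> 2 + 6 * \<beta> 1 ^ 3) * ((w 1)\<^sup>2 * w 2)
     + (6 * \<beta> 4 + 8 * \<beta> 1 * \<beta> 3 + 3 * (\<beta> 2)\<^sup>2 + 6 * (\<beta> 1)\<^sup>2 * \<beta> 2 + \<beta> 1 ^ 4) * w 1 ^ 4"
    by algebra
  thus ?thesis by (simp only: a5_def A_def)
qed

section \<open>The extremal function\<close>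

text \<open>The equation prescribes the logarithmic derivative of f', so f' is taken as
  \<open>exp (H z - H 0)\<close> with \<open>H\<close> a primitive of
  \<open>(\<phi> (z ^ Suc k) - 1) / z\<close>. It has no zeros and equals 1 at 0.\<close>

lemma convex_function_for_power:
  assumes \<phi>: "\<phi> holomorphic_on unit_disc" and \<phi>0: "\<phi> 0 = 1"
  obtains f where "f \<in> normalized_analytic" "\<And>z. z \<in> unit_disc \<Longrightarrow> deriv f z \<noteq> 0"
    "\<And>z. z \<in> unit_disc \<Longrightarrow> 1 + z * deriv (deriv f) z / deriv f z = \<phi> (z ^ Suc k)"
proof -
  \<comment> \<open>The difference quotient of \<phi> at 0 with its singularity removed:
    \<open>z ^ k * d (z ^ Suc k)\<close> extends \<open>(\<phi> (z ^ Suc k) - 1) / z\<close>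
    holomorphically to 0.\<close>
  define d where "d = (\<lambda>u. if u = 0 then deriv \<phi> 0 else (\<phi> u - \<phi> 0) / (u - 0))"
  have "d holomorphic_on unit_disc"
    unfolding d_def by (rule pole_lemma[OF \<phi>]) simp
  moreover have pw: "z ^ Suc k \<in> unit_disc" if "z \<in> unit_disc" for z :: complex
    using that by (simp add: norm_power power_less_one_iff del: power_Suc)
  moreover have "(\<lambda>z. z ^ Suc k) holomorphic_on unit_disc" by (intro holomorphic_intros)
  ultimately have "(d \<circ> (\<lambda>z. z ^ Suc k)) holomorphic_on unit_disc"
    by (intro holomorphic_on_compose_gen) auto
  hence "(\<lambda>z. d (z ^ Suc k)) holomorphic_on unit_disc" by (simp only: o_def)
  hence "(\<lambda>z. z ^ k * d (z ^ Suc k)) holomorphic_on unit_disc"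
    by (intro holomorphic_intros)
  then obtain H where H: "\<And>z. z \<in> unit_disc \<Longrightarrow>
      (H has_field_derivative z ^ k * d (z ^ Suc k)) (at z within unit_disc)"
    using holomorphic_convex_primitive'[of unit_disc "\<lambda>z. z ^ k * d (z ^ Suc k)"] by auto
  hence H': "(H has_field_derivative z ^ k * d (z ^ Suc k)) (at z)" if "z \<in> unit_disc" for z
    using that at_within_open[of z unit_disc] by (metis open_ball)
  define E where "E = (\<lambda>z. exp (H z - H 0))"
  have E: "(E has_field_derivative E z * (z ^ k * d (z ^ Suc k))) (at z)" if "z \<in> unit_disc" for z
    unfolding E_def by (auto intro!: derivative_eq_intros H' that)
  hence "E holomorphic_on unit_disc" using holomorphic_on_open[of unit_disc E] by blast
  then obtain g where g: "\<And>z. z \<in> unit_disc \<Longrightarrow> (g has_field_derivative E z) (at z within unit_disc)"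
    using holomorphic_convex_primitive'[of unit_disc E] by auto
  define f where "f = (\<lambda>z. g z - g 0)"
  have f: "(f has_field_derivative E z) (at z)" if "z \<in> unit_disc" for z
  proof -
    have "(g has_field_derivative E z) (at z)"
      using g[OF that] that at_within_open[of z unit_disc] by (metis open_ball)
    thus ?thesis unfolding f_def by (auto intro!: derivative_eq_intros)
  qed
  have df: "deriv f z = E z" if "z \<in> unit_disc" for z
    using f[OF that] by (rule DERIV_imp_deriv)
  have ddf: "deriv (deriv f) z = E z * (z ^ k * d (z ^ Suc k))" if z: "z \<in> unit_disc" for z
  proof -
    have "(deriv f has_field_derivative E z * (z ^ k * d (z ^ Suc k))) (at z)"
      by (rule has_field_derivative_transform_within_open[OF E[OF z], of unit_disc]) (use z df in auto)
    thus ?thesis by (rule DERIV_imp_deriv)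
  qed
  show ?thesis
  proof (rule that[of f])
    have "f holomorphic_on unit_disc" using f holomorphic_on_open[of unit_disc f] by blast
    moreover have "taylor_coeff f 1 = deriv f 0" by (simp add: fps_expansion_def)
    ultimately show "f \<in> normalized_analytic"
      by (simp add: normalized_analytic_def taylor_coeff_0 f_def[THEN fun_cong] df E_def)
    show "deriv f z \<noteq> 0" if "z \<in> unit_disc" for z
      using df[OF that] by (simp add: E_def)
    show "1 + z * deriv (deriv f) z / deriv f z = \<phi> (z ^ Suc k)" if z: "z \<in> unit_disc" for z
    proof -
      have "z * deriv (deriv f) z / deriv f z = z ^ Suc k * d (z ^ Suc k)"
        using df[OF z] ddf[OF z] by (simp add: E_def)
      also have "\<dots> = \<phi> (z ^ Suc k) - 1" by (simp add: d_def \<phi>0)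
      finally show ?thesis by simp
    qed
  qed
qed

theorem theorem6:
  fixes \<phi> :: "complex \<Rightarrow> complex" and B :: "nat \<Rightarrow> real"
  assumes "ma_minda \<phi>"
    and "\<And>n. taylor_coeff \<phi> n = complex_of_real (B n)"
    and "B 1 > 0"
    and C1: "\<bar>(B 1)^2 + 2 * B 2\<bar> < 2 * B 1"
    and C2: "\<bar>(B 1)^3 - (B 1)^2 * B 2 + 18 * (B 2)^2 - 18 * B 1 * B 3\<bar>
               < 3 * \<bar>((B 1)^2 + 2 * B 1 + 2 * B 2) * (2 * (B 1)^2 - 3 * B 1 + 3 * B 2)\<bar>"
    and C3: "\<bar>N_poly (B 1) (B 2) (B 3) (B 4)\<bar> < 8 * \<bar>D_poly (B 1) (B 2) (B 3)\<bar>"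
    and C4: "0 < (4 * (B 1)^2 + 6 * (B 2 - B 1)) / (3 * (B 1)^2 + 6 * (B 2 - B 1))"
            "(4 * (B 1)^2 + 6 * (B 2 - B 1)) / (3 * (B 1)^2 + 6 * (B 2 - B 1)) < 1"
  shows "(\<forall>f\<in>ma_minda_convex \<phi>. norm (taylor_coeff f 5) \<le> B 1 / 20) \<and>
         (\<exists>f\<in>ma_minda_convex \<phi>. norm (taylor_coeff f 5) = B 1 / 20)"
proof (intro conjI ballI)
  have \<phi>: "\<phi> holomorphic_on unit_disc" and \<phi>0: "\<phi> 0 = 1"
    using assms(1) by (auto simp: ma_minda_def)
  define x B2 B3 B4 where "x = B 1" and "B2 = B 2" and "B3 = B 3" and "B4 = B 4"
  note B = assms(2)[of 1, folded x_def] assms(2)[of 2, folded B2_def]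
    assms(2)[of 3, folded B3_def] assms(2)[of 4, folded B4_def]
  {
    fix f assume "f \<in> ma_minda_convex \<phi>"
    then obtain \<omega> where f: "f holomorphic_on unit_disc" "taylor_coeff f 1 = 1"
      "\<And>z. z \<in> unit_disc \<Longrightarrow> deriv f z \<noteq> 0"
      and \<omega>: "schwarz_function \<omega>"
      and eq: "\<And>z. z \<in> unit_disc \<Longrightarrow> 1 + z * deriv (deriv f) z / deriv f z = \<phi> (\<omega> z)"
      by (auto simp: ma_minda_convex_def normalized_analytic_def subordinate_def)
    obtain m b c r m2 m3 where par: "\<bar>m\<bar> < 1" "\<bar>b\<bar> < 1" "\<bar>c\<bar> < 1" "0 < r" "r < 1"
      "m2 = m\<^sup>2 + (1 - m\<^sup>2) * b"
      "m3 = m ^ 3 + 2 * m * (1 - m\<^sup>2) * b + (1 - m\<^sup>2) * ((1 - b\<^sup>2) * c - m * b\<^sup>2)"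
      and k: "x * (2 - 2 * (1 + m) * r) = 2 * B2 + 4 / 3 * x\<^sup>2"
      "x * (- m) = B2 + x\<^sup>2 / 2"
      "x * (3 - (1 + m) * (4 * r + 2) + 3 * (1 + 2 * m + m2) * r) = 3 * B3 + 11 / 3 * x * B2 + x ^ 3"
      "x * (1 - (1 + m) * (2 * r + 1) + 3 * (1 + 2 * m + m2) * r - (1 + 3 * m + 3 * m2 + m3) * r\<^sup>2)
         = B4 + 4 / 3 * x * B3 + B2\<^sup>2 / 2 + x\<^sup>2 * B2 + x ^ 4 / 6"
      using coefficient_parameters[OF assms(3) C1 C2 C3 C4, folded x_def B2_def B3_def B4_def] by blast
    define w where "w = taylor_coeff \<omega>"
    define k1 k2 k3 k4 where "k1 = 2 - 2 * (1 + m) * r" and "k2 = - m"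
      and "k3 = 3 - (1 + m) * (4 * r + 2) + 3 * (1 + 2 * m + m2) * r"
      and "k4 = 1 - (1 + m) * (2 * r + 1) + 3 * (1 + 2 * m + m2) * r - (1 + 3 * m + 3 * m2 + m3) * r\<^sup>2"
    define S where "S = w 4 + of_real k1 * (w 1 * w 3) + of_real k2 * (w 2)\<^sup>2
      + of_real k3 * ((w 1)\<^sup>2 * w 2) + of_real k4 * w 1 ^ 4"
    have S: "norm S \<le> 1"
      unfolding S_def w_def k1_def k2_def k3_def k4_def
      by (rule schwarz_quartic_bound[OF \<omega> par(1-3) less_imp_le[OF par(4)] less_imp_le[OF par(5)] par(6,7)])
    \<comment> \<open>Six times the parameter equations: the left-hand sides are now the
      coefficients in \<open>fifth_coefficient\<close>, so that
      \<open>120 a5 = 6 * x * S\<close>.\<close>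
    have k': "12 * B2 + 8 * x\<^sup>2 = 6 * x * k1" "6 * B2 + 3 * x\<^sup>2 = 6 * x * k2"
      "18 * B3 + 22 * x * B2 + 6 * x ^ 3 = 6 * x * k3"
      "6 * B4 + 8 * x * B3 + 3 * B2\<^sup>2 + 6 * x\<^sup>2 * B2 + x ^ 4 = 6 * x * k4"
      using k[folded k1_def k2_def k3_def k4_def] by simp_all
    have "120 * taylor_coeff f 5 = of_real (6 * x) * w 4 + of_real (12 * B2 + 8 * x\<^sup>2) * (w 1 * w 3)
       + of_real (6 * B2 + 3 * x\<^sup>2) * (w 2)\<^sup>2
       + of_real (18 * B3 + 22 * x * B2 + 6 * x ^ 3) * ((w 1)\<^sup>2 * w 2)
       + of_real (6 * B4 + 8 * x * B3 + 3 * B2\<^sup>2 + 6 * x\<^sup>2 * B2 + x ^ 4) * w 1 ^ 4"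
      using fifth_coefficient[OF f \<phi> \<phi>0 \<omega> eq] unfolding B w_def by simp
    also have "\<dots> = of_real (6 * x) * S"
      unfolding k' S_def of_real_mult by (simp only: distrib_left mult.assoc)
    finally have "norm (120 * taylor_coeff f 5) = \<bar>6 * x\<bar> * norm S"
      by (simp only: norm_mult norm_of_real)
    also have "\<dots> \<le> \<bar>6 * x\<bar> * 1" using S by (intro mult_left_mono) auto
    also have "\<dots> = 6 * x" using assms(3) by (simp add: x_def)
    finally show "norm (taylor_coeff f 5) \<le> B 1 / 20" by (simp add: norm_mult x_def)
  }
  \<comment> \<open>For \<omega> equal to the fourth power, \<open>w 4 = 1\<close> is the only
    nonzero coefficient, so just the first term of \<open>fifth_coefficient\<close> remains.\<close>
  obtain f where f: "f \<in> normalized_analytic" "\<And>z. z \<in> unit_disc \<Longrightarrow> deriv f z \<noteq> 0"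
    and eq: "\<And>z. z \<in> unit_disc \<Longrightarrow> 1 + z * deriv (deriv f) z / deriv f z = \<phi> (z ^ Suc 3)"
    using convex_function_for_power[OF \<phi> \<phi>0, of 3] by blast
  have hol: "f holomorphic_on unit_disc" and f1: "taylor_coeff f 1 = 1"
    using f(1) by (auto simp: normalized_analytic_def)
  have \<omega>: "schwarz_function (\<lambda>z. z ^ Suc 3)"
    by (auto simp: schwarz_function_def norm_power power_less_one_iff simp del: power_Suc
        intro!: holomorphic_intros)
  \<comment> \<open>Subordination includes holomorphy of the quotient, which follows from the
    nonvanishing of f'.\<close>
  have "(\<lambda>z. 1 + z * deriv (deriv f) z / deriv f z) holomorphic_on unit_disc"
    using f(2) by (intro holomorphic_intros hol) auto
  hence "f \<in> ma_minda_convex \<phi>"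
    using f \<phi> \<omega> eq unfolding ma_minda_convex_def subordinate_def by blast
  moreover have "norm (taylor_coeff f 5) = B 1 / 20"
  proof -
    have "(\<lambda>z::complex. z ^ Suc 3) has_fps_expansion fps_X ^ Suc 3"
      by (rule has_fps_expansion_fps_X_power)
    hence "fps_expansion (\<lambda>z::complex. z ^ Suc 3) 0 = fps_X ^ Suc 3" by (rule fps_expansion_eqI)
    hence "taylor_coeff (\<lambda>z. z ^ Suc 3) n = (if n = 4 then 1 else 0)" for n
      by (simp only: fps_X_power_nth) simp
    hence "120 * taylor_coeff f 5 = of_real (6 * x)"
      using fifth_coefficient[OF hol f1 f(2) \<phi> \<phi>0 \<omega> eq] unfolding B by (simp del: power_Suc)
    hence "norm (120 * taylor_coeff f 5) = \<bar>6 * x\<bar>" by (simp only: norm_of_real)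
    thus ?thesis using assms(3) by (simp only: norm_mult) (simp add: x_def)
  qed
  ultimately show "\<exists>f\<in>ma_minda_convex \<phi>. norm (taylor_coeff f 5) = B 1 / 20" by blast
qed

end
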